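(* Let $\mathcal R$ be a hyperfinite pmp equivalence relation on a standard probability space $(X,\mu)$. Then its full group $[\mathcal R]$, with the uniform topology, is extremely amenable.
   Context: Everything is understood modulo null sets. $(X,\mu)$ is a standard (atomless) probability space; $\mathrm{Aut}(X,\mu)$ is the group of measure-preserving Borel bijections of $X$ up to null sets. A pmp equivalence relation is the orbit equivalence relation of a measure-preserving action of a countable group on $(X,\mu)$. It is finite if all its classes are finite, and hyperfinite if it can be written as a countable increasing union of finite pmp equivalence relations. The full group is $[\mathcal R]=\{T\in\mathrm{Aut}(X,\mu): T(x)\,\mathcal R\,x \text{ for a.e. } x\}$, with the topology of the uniform metric $d_u(T,T')=\mu(\{x:T(x)\neq T'(x)\})$. A topological group $G$ is extremely amenable if every continuous $G$-action on a (nonempty) compact Hausdorff space has a fixed point. *)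

theory Defs
  imports "HOL-Probability.Probability" "HOL-Algebra.Group_Action"
begin

section \<open>Standard probability spaces\<close>

text \<open>The sigma-algebra is the Borel one, not its completion; null sets are handled by the
  almost-everywhere quantifier.\<close>

definition standard_borel :: "'a measure \<Rightarrow> bool" where
  "standard_borel M \<longleftrightarrow>
     (\<exists>S. topspace S = space M \<and> completely_metrizable_space S \<and> second_countable S \<and>
          sets M = sigma_sets (space M) {U. openin S U})"

definition atomless :: "'a measure \<Rightarrow> bool" where
  "atomless M \<longleftrightarrow>
     (\<forall>A\<in>sets M. 0 < emeasure M A \<longrightarrow>
        (\<exists>B\<in>sets M. B \<subseteq> A \<and> 0 < emeasure M B \<and> emeasure M B < emeasure M A))"

definition standard_probability_space :: "'a measure \<Rightarrow> bool" where
  "standard_probability_space M \<longleftrightarrow> prob_space M \<and> standard_borel M \<and> atomless M"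


section \<open>The group of measure-preserving automorphisms\<close>

definition mp_bij :: "'a measure \<Rightarrow> ('a \<Rightarrow> 'a) set" where
  "mp_bij M = {T \<in> Bij (space M).
     T \<in> M \<rightarrow>\<^sub>M M \<and> inv_into (space M) T \<in> M \<rightarrow>\<^sub>M M \<and> distr M M T = M}"

definition ae_identity :: "'a measure \<Rightarrow> ('a \<Rightarrow> 'a) set" where
  "ae_identity M = {T \<in> mp_bij M. AE x in M. T x = x}"

text \<open>Two measure-preserving bijections lie in the same coset of the normal subgroup
  \<open>ae_identity M\<close> iff they agree almost everywhere, so the quotient is the group of
  measure-preserving Borel bijections up to null sets. Its elements are cosets, that is,
  sets of functions.\<close>

definition Aut :: "'a measure \<Rightarrow> ('a \<Rightarrow> 'a) set monoid" where
  "Aut M = (BijGroup (space M)\<lparr>carrier := mp_bij M\<rparr>) Mod ae_identity M"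

text \<open>The uniform metric on \<open>Aut M\<close>; its value does not depend on the representatives chosen.\<close>

definition uniform_dist :: "'a measure \<Rightarrow> ('a \<Rightarrow> 'a) set \<Rightarrow> ('a \<Rightarrow> 'a) set \<Rightarrow> real" where
  "uniform_dist M a b =
     measure M {x \<in> space M. (SOME T. T \<in> a) x \<noteq> (SOME T. T \<in> b) x}"


section \<open>Equivalence relations and full groups\<close>

text \<open>Relations are subsets of the square of the space. They are compared modulo null sets:
  two of them are identified when almost every point has the same class for both.
  Every countable group has an isomorphic copy carried by a set of natural numbers, and every
  group carried by such a set is countable.\<close>

definition pmp_equiv_rel :: "'a measure \<Rightarrow> ('a \<times> 'a) set \<Rightarrow> bool" where
  "pmp_equiv_rel M R \<longleftrightarrow>
     equiv (space M) R \<and>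
     (\<exists>(\<Gamma> :: nat monoid) \<alpha>.
        group_action \<Gamma> (space M) \<alpha> \<and> (\<forall>g\<in>carrier \<Gamma>. \<alpha> g \<in> mp_bij M) \<and>
        (AE x in M. R `` {x} = orbit \<Gamma> \<alpha> x))"

definition finite_rel :: "'a measure \<Rightarrow> ('a \<times> 'a) set \<Rightarrow> bool" where
  "finite_rel M R \<longleftrightarrow> (AE x in M. finite (R `` {x}))"

definition hyperfinite :: "'a measure \<Rightarrow> ('a \<times> 'a) set \<Rightarrow> bool" where
  "hyperfinite M R \<longleftrightarrow>
     (\<exists>F :: nat \<Rightarrow> ('a \<times> 'a) set.
        (\<forall>n. pmp_equiv_rel M (F n) \<and> finite_rel M (F n)) \<and>
        (\<forall>n. AE x in M. F n `` {x} \<subseteq> F (Suc n) `` {x}) \<and>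
        (AE x in M. R `` {x} = (\<Union>n. F n `` {x})))"

text \<open>The condition on a coset does not depend on the representative.\<close>

definition full_group ::
  "'a measure \<Rightarrow> ('a \<times> 'a) set \<Rightarrow> ('a \<Rightarrow> 'a) set monoid" where
  "full_group M R =
     (Aut M)\<lparr>carrier := {a \<in> carrier (Aut M). \<exists>T\<in>a. AE x in M. (T x, x) \<in> R}\<rparr>"

definition full_group_topology ::
  "'a measure \<Rightarrow> ('a \<times> 'a) set \<Rightarrow> ('a \<Rightarrow> 'a) set topology" where
  "full_group_topology M R =
     Metric_space.mtopology (carrier (full_group M R)) (uniform_dist M)"


section \<open>Extreme amenability\<close>

definition topological_group :: "('g, 'm) monoid_scheme \<Rightarrow> 'g topology \<Rightarrow> bool" where
  "topological_group G \<tau> \<longleftrightarrow>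
     group G \<and> topspace \<tau> = carrier G \<and>
     continuous_map (prod_topology \<tau> \<tau>) \<tau> (\<lambda>(g, h). g \<otimes>\<^bsub>G\<^esub> h) \<and>
     continuous_map \<tau> \<tau> (\<lambda>g. inv\<^bsub>G\<^esub> g)"

definition continuous_action ::
  "('g, 'm) monoid_scheme \<Rightarrow> 'g topology \<Rightarrow> 'k topology \<Rightarrow> ('g \<Rightarrow> 'k \<Rightarrow> 'k) \<Rightarrow> bool" where
  "continuous_action G \<tau> K \<phi> \<longleftrightarrow>
     group_action G (topspace K) \<phi> \<and>
     continuous_map (prod_topology \<tau> K) K (\<lambda>(g, x). \<phi> g x)"

text \<open>A definition cannot quantify over types, so the type \<open>'k\<close> of points of the compact
  spaces is a parameter. Extreme amenability is this property for all \<open>'k\<close>: a theorem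
  concluding it must leave \<open>'k\<close> a free type variable.\<close>

definition extremely_amenable ::
  "'k itself \<Rightarrow> ('g, 'm) monoid_scheme \<Rightarrow> 'g topology \<Rightarrow> bool" where
  "extremely_amenable (_ :: 'k itself) G \<tau> \<longleftrightarrow>
     topological_group G \<tau> \<and>
     (\<forall>(K :: 'k topology) \<phi>.
        compact_space K \<and> Hausdorff_space K \<and> topspace K \<noteq> {} \<and> continuous_action G \<tau> K \<phi>
        \<longrightarrow> (\<exists>x\<in>topspace K. \<forall>g\<in>carrier G. \<phi> g x = x))"

end

(* The full group has a Levy property. Given finitely many
   elements of [R], exhaust R by finite relations: outside a set of small measure each of them
   preserves classes of bounded size, and the resulting partial isomorphism is closed up to an
   automorphism preserving these classes. Permutations of classes of bounded size generate a finite
   group S. Since the space is atomless, it splits into S-invariant blocks of small measure, and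
   applying an element of S independently on each of n blocks maps S^n to the full group; this map is
   Lipschitz for a Hamming distance whose weights are the measures of the blocks. A martingale-type
   variance estimate shows that Lipschitz functions on S^n are nearly constant, so that orbit maps
   of a continuous action on a compact space yield almost fixed points, and fixed points by
   compactness. *)

theory Submission
  imports Defs
begin

section \<open>Concentration on finite powers\<close>

text \<open>Two invariances drive the argument. Right invariance of the uniform metric makes
  \<open>g \<mapsto> f (g x)\<close> uniformly continuous on the group. Left translation by one
  element of \<open>S\<close> becomes, through the block map, the diagonal translation of
  \<open>S^n\<close>, which preserves the uniform average; so a concentrated function and its
  translate are close to the same mean. Second moments suffice: the sum of the squared block
  measures is at most the largest block measure, whatever the number of blocks. Hence the blocks may
  be chosen last, after \<open>S\<close> and after the finitely many test functions. Null sets shape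
  the rest. The finite relations and their inclusions are controlled only almost everywhere, but
  closing up chains and cutting into invariant blocks need exact classes at every point. The classes
  are therefore taken to be orbits of the acting groups, which form a true partition; their
  finiteness, monotonicity and exhaustion of \<open>R\<close> remain almost-everywhere
  statements.\<close>

primrec avg :: "'s set \<Rightarrow> nat \<Rightarrow> ('s list \<Rightarrow> real) \<Rightarrow> real" where
  "avg S 0 f = f []"
| "avg S (Suc n) f = (\<Sum>s\<in>S. avg S n (\<lambda>xs. f (s # xs))) / card S"

lemma avg_add: "avg S n (\<lambda>xs. f xs + g xs) = avg S n f + avg S n g"
  by (induction n arbitrary: f g) (simp_all add: sum.distrib add_divide_distrib)

lemma avg_cmult: "avg S n (\<lambda>xs. c * f xs) = c * avg S n f"
  by (induction n arbitrary: f) (simp_all add: sum_distrib_left)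

lemma avg_sum: "finite P \<Longrightarrow> avg S n (\<lambda>xs. \<Sum>p\<in>P. f p xs) = (\<Sum>p\<in>P. avg S n (f p))"
proof (induction P rule: finite_induct)
  case empty
  show ?case using avg_cmult[of S n 0 "\<lambda>_. 0"] by simp
next
  case (insert p P)
  then show ?case by (simp add: avg_add)
qed

lemma avg_const: "finite S \<Longrightarrow> S \<noteq> {} \<Longrightarrow> avg S n (\<lambda>_. c) = c"
  by (induction n) auto

lemma avg_mono:
  assumes "\<And>xs. length xs = n \<Longrightarrow> set xs \<subseteq> S \<Longrightarrow> f xs \<le> g xs"
  shows "avg S n f \<le> avg S n g"
  using assms
proof (induction n arbitrary: f g)
  case (Suc n)
  have "avg S n (\<lambda>xs. f (s # xs)) \<le> avg S n (\<lambda>xs. g (s # xs))" if "s \<in> S" for s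
    by (rule Suc.IH) (use that in \<open>auto intro!: Suc.prems\<close>)
  then show ?case by (auto intro!: divide_right_mono sum_mono)
qed simp

text \<open>The uniform measure on the power is invariant under a bijection applied to every
  coordinate: one reindexes the sum over the head and uses induction for the tail. Group translation
  enters the concentration argument only through this invariance.\<close>

lemma avg_map:
  assumes "bij_betw \<gamma> S S"
  shows "avg S n (\<lambda>xs. f (map \<gamma> xs)) = avg S n f"
proof (induction n arbitrary: f)
  case (Suc n)
  have "(\<Sum>s\<in>S. avg S n (\<lambda>xs. f (\<gamma> s # map \<gamma> xs))) = (\<Sum>s\<in>S. avg S n (\<lambda>xs. f (\<gamma> s # xs)))"
    using Suc.IH[of "\<lambda>xs. f (\<gamma> s # xs)" for s] by simp
  also have "\<dots> = (\<Sum>s\<in>S. avg S n (\<lambda>xs. f (s # xs)))"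
    using sum.reindex_bij_betw[OF assms, of "\<lambda>s. avg S n (\<lambda>xs. f (s # xs))"] .
  finally show ?case by simp
qed simp

lemma avg_less_imp_ex:
  assumes "finite S" "S \<noteq> {}" "avg S n f < c"
  shows "\<exists>xs. length xs = n \<and> set xs \<subseteq> S \<and> f xs < c"
proof (rule ccontr)
  assume "\<nexists>xs. length xs = n \<and> set xs \<subseteq> S \<and> f xs < c"
  then have "avg S n (\<lambda>_. c) \<le> avg S n f" by (intro avg_mono) (auto simp: not_less)
  with assms show False by (simp add: avg_const)
qed

definition variance_on :: "'s set \<Rightarrow> nat \<Rightarrow> ('s list \<Rightarrow> real) \<Rightarrow> real" where
  "variance_on S n f = avg S n (\<lambda>xs. (f xs - avg S n f)\<^sup>2)"

text \<open>Decomposition of a second moment about \<open>c\<close> into variance and squared bias.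
  With \<open>c\<close> the mean over all coordinates and \<open>f\<close> restricted to a fixed
  head, it yields the law of total variance.\<close>

lemma avg_square_diff:
  assumes "finite S" "S \<noteq> {}"
  shows "avg S n (\<lambda>xs. (f xs - c)\<^sup>2) = variance_on S n f + (avg S n f - c)\<^sup>2"
proof -
  let ?m = "avg S n f"
  have "avg S n (\<lambda>xs. (f xs - c)\<^sup>2)
      = avg S n (\<lambda>xs. (f xs - ?m)\<^sup>2 + ((2 * (?m - c)) * f xs + (c\<^sup>2 - ?m\<^sup>2)))"
    by (rule arg_cong[where f = "avg S n"]) (auto simp: fun_eq_iff power2_eq_square algebra_simps)
  also have "\<dots> = variance_on S n f + (2 * (?m - c) * ?m + (c\<^sup>2 - ?m\<^sup>2))"
    unfolding avg_add avg_cmult avg_const[OF assms] variance_on_def ..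
  also have "2 * (?m - c) * ?m + (c\<^sup>2 - ?m\<^sup>2) = (?m - c)\<^sup>2"
    by (auto simp: power2_eq_square algebra_simps)
  finally show ?thesis .
qed

definition hamming :: "(nat \<Rightarrow> real) \<Rightarrow> 's list \<Rightarrow> 's list \<Rightarrow> real" where
  "hamming w xs ys = (\<Sum>i<length xs. if xs ! i \<noteq> ys ! i then w i else 0)"

lemma hamming_Cons:
  "hamming w (x # xs) (y # ys) = (if x \<noteq> y then w 0 else 0) + hamming (\<lambda>i. w (Suc i)) xs ys"
  by (simp add: hamming_def sum.lessThan_Suc_shift del: sum.lessThan_Suc)

text \<open>The law of total variance splits off the first coordinate. The conditional mean
  \<open>m s\<close> oscillates by at most \<open>w 0\<close>, and for each fixed head the tail is
  again Lipschitz, now for the shifted weights; hence the induction generalizes over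
  \<open>w\<close>.\<close>

lemma variance_on_le:
  assumes "finite S" "S \<noteq> {}"
    and "\<And>xs ys. \<lbrakk>length xs = n; set xs \<subseteq> S; length ys = n; set ys \<subseteq> S\<rbrakk>
           \<Longrightarrow> \<bar>f xs - f ys\<bar> \<le> hamming w xs ys"
    and "\<And>i. 0 \<le> w i"
  shows "variance_on S n f \<le> (\<Sum>i<n. (w i)\<^sup>2)"
  using assms(3,4)
proof (induction n arbitrary: f w)
  case 0
  show ?case by (simp add: variance_on_def)
next
  case (Suc n)
  define m where "m s = avg S n (\<lambda>xs. f (s # xs))" for s
  let ?M = "avg S (Suc n) f"
  have c: "real (card S) > 0" using assms(1,2) by (simp add: card_gt_0_iff)
  have M: "?M = (\<Sum>s\<in>S. m s) / card S" by (simp add: m_def)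
  have IH: "variance_on S n (\<lambda>xs. f (s # xs)) \<le> (\<Sum>i<n. (w (Suc i))\<^sup>2)" if "s \<in> S" for s
  proof (rule Suc.IH)
    fix xs ys assume "length xs = n" "set xs \<subseteq> S" "length ys = n" "set ys \<subseteq> S"
    then show "\<bar>f (s # xs) - f (s # ys)\<bar> \<le> hamming (\<lambda>i. w (Suc i)) xs ys"
      using Suc.prems(1)[of "s # xs" "s # ys"] that by (simp add: hamming_Cons)
  qed (rule Suc.prems)
  have m_diff: "m s \<le> m t + w 0" if "s \<in> S" "t \<in> S" for s t
  proof -
    have "m s \<le> avg S n (\<lambda>xs. f (t # xs) + w 0)" unfolding m_def
    proof (rule avg_mono)
      fix xs assume "length xs = n" "set xs \<subseteq> S"
      then have "\<bar>f (s # xs) - f (t # xs)\<bar> \<le> hamming w (s # xs) (t # xs)"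
        using Suc.prems(1)[of "s # xs" "t # xs"] that by simp
      also have "\<dots> \<le> w 0" using Suc.prems(2)[of 0] by (simp add: hamming_Cons) (simp add: hamming_def)
      finally show "f (s # xs) \<le> f (t # xs) + w 0" by simp
    qed
    then show ?thesis by (simp add: avg_add avg_const[OF assms(1,2)] m_def)
  qed
  have mM: "(m s - ?M)\<^sup>2 \<le> (w 0)\<^sup>2" if "s \<in> S" for s
  proof -
    have "(\<Sum>t\<in>S. m s) \<le> (\<Sum>t\<in>S. m t + w 0)" using m_diff that by (intro sum_mono) auto
    then have "m s \<le> ?M + w 0" using c unfolding M by (simp add: sum.distrib field_simps)
    moreover have "(\<Sum>t\<in>S. m t) \<le> (\<Sum>t\<in>S. m s + w 0)" using m_diff that by (intro sum_mono) auto
    then have "?M \<le> m s + w 0" using c unfolding M by (simp add: field_simps)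
    ultimately have "\<bar>m s - ?M\<bar> \<le> w 0" by linarith
    then show ?thesis by (metis abs_le_square_iff abs_of_nonneg Suc.prems(2))
  qed
  have "variance_on S (Suc n) f = (\<Sum>s\<in>S. avg S n (\<lambda>xs. (f (s # xs) - ?M)\<^sup>2)) / card S"
    unfolding variance_on_def by simp
  \<comment> \<open>The variance within the slice of head \<open>s\<close> plus the squared distance
    of its mean from the global mean.\<close>
  also have "\<dots> = (\<Sum>s\<in>S. variance_on S n (\<lambda>xs. f (s # xs)) + (m s - ?M)\<^sup>2) / card S"
    unfolding avg_square_diff[OF assms(1,2)] m_def ..
  also have "\<dots> \<le> (\<Sum>s\<in>S. (\<Sum>i<n. (w (Suc i))\<^sup>2) + (w 0)\<^sup>2) / card S"
    by (intro divide_right_mono sum_mono add_mono IH mM) auto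
  also have "\<dots> = (\<Sum>i<Suc n. (w i)\<^sup>2)"
    using c by (simp add: sum.lessThan_Suc_shift del: sum.lessThan_Suc)
  finally show ?case .
qed

text \<open>A first-moment argument: the squared displacements, summed over all \<open>p\<close>,
  have average below \<open>c\<^sup>2\<close>, so a single \<open>xs\<close> serves every
  \<open>p\<close> at once. The factor 4 comes from comparing both values with the mean: each
  deviation enters with factor 2, and by invariance under \<open>\<gamma> p\<close> both have the
  same second moment.\<close>

lemma exists_almost_invariant:
  fixes w :: "nat \<Rightarrow> real"
  assumes S: "finite S" "S \<noteq> {}" and "finite P" "0 < c"
    and bij: "\<And>p. p \<in> P \<Longrightarrow> bij_betw (\<gamma> p) S S"
    and lip: "\<And>p xs ys. \<lbrakk>p \<in> P; length xs = n; set xs \<subseteq> S; length ys = n; set ys \<subseteq> S\<rbrakk>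
           \<Longrightarrow> \<bar>f p xs - f p ys\<bar> \<le> hamming w xs ys"
    and w: "\<And>i. 0 \<le> w i" "4 * real (card P) * (\<Sum>i<n. (w i)\<^sup>2) < c\<^sup>2"
  shows "\<exists>xs. length xs = n \<and> set xs \<subseteq> S \<and> (\<forall>p\<in>P. \<bar>f p (map (\<gamma> p) xs) - f p xs\<bar> < c)"
proof -
  have bound: "avg S n (\<lambda>xs. (f p (map (\<gamma> p) xs) - f p xs)\<^sup>2) \<le> 4 * (\<Sum>i<n. (w i)\<^sup>2)"
    if "p \<in> P" for p
  proof -
    let ?m = "avg S n (f p)"
    have "avg S n (\<lambda>xs. (f p (map (\<gamma> p) xs) - f p xs)\<^sup>2)
      \<le> avg S n (\<lambda>xs. 2 * (f p (map (\<gamma> p) xs) - ?m)\<^sup>2 + 2 * (f p xs - ?m)\<^sup>2)"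
    proof (rule avg_mono)
      fix xs
      have "(a - b)\<^sup>2 \<le> 2 * (a - m)\<^sup>2 + 2 * (b - m)\<^sup>2" for a b m :: real
        \<comment> \<open>The difference of the two sides is exactly this square.\<close>
        using zero_le_power2[of "a + b - 2 * m"] by (simp add: power2_eq_square algebra_simps)
      then show "(f p (map (\<gamma> p) xs) - f p xs)\<^sup>2
        \<le> 2 * (f p (map (\<gamma> p) xs) - ?m)\<^sup>2 + 2 * (f p xs - ?m)\<^sup>2" .
    qed
    also have "\<dots> = 4 * variance_on S n (f p)"
      unfolding avg_add avg_cmult avg_map[OF bij[OF that], of n "\<lambda>xs. (f p xs - ?m)\<^sup>2"]
      by (simp add: variance_on_def)
    also have "\<dots> \<le> 4 * (\<Sum>i<n. (w i)\<^sup>2)"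
      using variance_on_le[OF S lip[OF that] w(1)] by simp
    finally show ?thesis .
  qed
  have "avg S n (\<lambda>xs. \<Sum>p\<in>P. (f p (map (\<gamma> p) xs) - f p xs)\<^sup>2)
      = (\<Sum>p\<in>P. avg S n (\<lambda>xs. (f p (map (\<gamma> p) xs) - f p xs)\<^sup>2))"
    by (rule avg_sum) fact
  also have "\<dots> \<le> (\<Sum>p\<in>P. 4 * (\<Sum>i<n. (w i)\<^sup>2))" by (intro sum_mono bound)
  also have "\<dots> < c\<^sup>2" using w(2) by (simp add: mult_ac)
  finally obtain xs where xs: "length xs = n" "set xs \<subseteq> S"
    "(\<Sum>p\<in>P. (f p (map (\<gamma> p) xs) - f p xs)\<^sup>2) < c\<^sup>2"
    using avg_less_imp_ex[OF S] by blast
  have "\<bar>f p (map (\<gamma> p) xs) - f p xs\<bar> < c" if "p \<in> P" for p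
  proof -
    have "(f p (map (\<gamma> p) xs) - f p xs)\<^sup>2 \<le> (\<Sum>p\<in>P. (f p (map (\<gamma> p) xs) - f p xs)\<^sup>2)"
      by (rule member_le_sum) (use that \<open>finite P\<close> in auto)
    with xs(3) have "\<bar>f p (map (\<gamma> p) xs) - f p xs\<bar>\<^sup>2 < c\<^sup>2" by simp
    then show ?thesis using \<open>0 < c\<close> power2_less_imp_less by fastforce
  qed
  with xs show ?thesis by blast
qed

section \<open>A fixed point criterion\<close>

text \<open>Infimal convolution of \<open>h\<close> with \<open>d / \<eta>\<close>. A point at
  distance at least \<open>\<eta>\<close> costs at least 1, the whole range of \<open>h\<close>, so
  only points where \<open>h\<close> differs by at most \<open>\<epsilon>\<close> can matter. It is
  used because the variance bound asks for Lipschitz functions, while orbit functions are only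
  uniformly continuous.\<close>

lemma (in Metric_space) lipschitz_approximation:
  assumes "0 < \<eta>" and h01: "\<And>a. a \<in> M \<Longrightarrow> 0 \<le> h a \<and> h a \<le> (1::real)"
    and unif: "\<And>a b. \<lbrakk>a \<in> M; b \<in> M; d a b < \<eta>\<rbrakk> \<Longrightarrow> \<bar>h a - h b\<bar> \<le> \<epsilon>" and "0 \<le> \<epsilon>"
  shows "\<exists>k. (\<forall>a\<in>M. \<bar>k a - h a\<bar> \<le> \<epsilon>) \<and> (\<forall>a\<in>M. \<forall>b\<in>M. \<bar>k a - k b\<bar> \<le> d a b / \<eta>)"
proof -
  define k where "k a = (INF b\<in>M. h b + d a b / \<eta>)" for a
  have bdd: "bdd_below ((\<lambda>b. h b + d a b / \<eta>) ` M)" for a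
    by (rule bdd_belowI[where m = 0]) (use h01 \<open>0 < \<eta>\<close> in auto)
  have lower: "k a \<le> h b + d a b / \<eta>" if "b \<in> M" for a b
    unfolding k_def by (rule cINF_lower[OF bdd that])
  have near: "\<bar>k a - h a\<bar> \<le> \<epsilon>" if a: "a \<in> M" for a
  proof -
    have "k a \<le> h a" using lower[OF a, of a] a by simp
    moreover have "h a - \<epsilon> \<le> k a" unfolding k_def
    proof (rule cINF_greatest)
      fix b assume b: "b \<in> M"
      show "h a - \<epsilon> \<le> h b + d a b / \<eta>"
      proof (cases "d a b < \<eta>")
        case True
        have "0 \<le> d a b / \<eta>" using \<open>0 < \<eta>\<close> by simp
        with unif[OF a b True] show ?thesis by linarith
      next
        case False
        then have "1 \<le> d a b / \<eta>" using \<open>0 < \<eta>\<close> by simp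
        with h01[OF a] h01[OF b] \<open>0 \<le> \<epsilon>\<close> show ?thesis by linarith
      qed
    qed (use a in auto)
    ultimately show ?thesis using \<open>0 \<le> \<epsilon>\<close> by linarith
  qed
  have half: "k a \<le> k b + d a b / \<eta>" if a: "a \<in> M" and b: "b \<in> M" for a b
  proof -
    have "k a - d a b / \<eta> \<le> k b" unfolding k_def[of b]
    proof (rule cINF_greatest)
      fix c assume c: "c \<in> M"
      have "d a c / \<eta> \<le> (d a b + d b c) / \<eta>"
        using triangle[OF a b c] \<open>0 < \<eta>\<close> by (simp add: divide_right_mono)
      with lower[OF c, of a] show "k a - d a b / \<eta> \<le> h c + d b c / \<eta>"
        by (simp add: add_divide_distrib)
    qed (use a in auto)
    then show ?thesis by simp
  qed
  have "\<bar>k a - k b\<bar> \<le> d a b / \<eta>" if "a \<in> M" "b \<in> M" for a b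
    using half[OF that] half[OF that(2,1)] by (simp add: commute abs_le_iff)
  with near show ?thesis by blast
qed

text \<open>Compactness makes the modulus uniform in \<open>y\<close>: the pairs
  \<open>(v, y)\<close> displacing \<open>f\<close> by at least \<open>e\<close> form a closed set,
  and its projection along the compact factor is closed and misses the identity.\<close>

lemma continuous_action_uniform:
  fixes K :: "'k topology" and f :: "'k \<Rightarrow> real"
  assumes "Metric_space (carrier G) d" "group G"
    and act: "continuous_action G (Metric_space.mtopology (carrier G) d) K \<phi>"
    and "compact_space K" and f: "continuous_map K euclideanreal f" and "0 < e"
  shows "\<exists>\<eta>>0. \<forall>v\<in>carrier G. d \<one>\<^bsub>G\<^esub> v < \<eta> \<longrightarrow> (\<forall>y\<in>topspace K. \<bar>f (\<phi> v y) - f y\<bar> < e)"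
proof -
  interpret Metric_space "carrier G" d by fact
  interpret group G by fact
  interpret group_action G "topspace K" \<phi> using act unfolding continuous_action_def by blast
  let ?P = "prod_topology mtopology K"
  have c1: "continuous_map ?P K (\<lambda>p. \<phi> (fst p) (snd p))"
    using act unfolding continuous_action_def by (simp add: case_prod_unfold)
  have "continuous_map ?P euclideanreal (\<lambda>p. \<bar>f (\<phi> (fst p) (snd p)) - f (snd p)\<bar>)"
    using continuous_map_compose[OF c1 f] continuous_map_compose[OF continuous_map_snd f]
    by (intro continuous_map_real_abs continuous_map_diff) (auto simp: o_def)
  then have "closedin ?P {p \<in> topspace ?P. \<bar>f (\<phi> (fst p) (snd p)) - f (snd p)\<bar> \<in> {e..}}"
    (is "closedin _ ?C")
    by (rule closedin_continuous_map_preimage) auto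
  then have "closedin mtopology (fst ` ?C)"
    using closed_map_fst[OF \<open>compact_space K\<close>] unfolding closed_map_def by blast
  then have "openin mtopology (topspace mtopology - fst ` ?C)" by (rule openin_diff[OF openin_topspace])
  then have "openin mtopology (carrier G - fst ` ?C)" unfolding topspace_mtopology .
  moreover have "\<one>\<^bsub>G\<^esub> \<in> carrier G - fst ` ?C"
  proof -
    have "\<phi> \<one>\<^bsub>G\<^esub> y = y" if "y \<in> topspace K" for y
      using id_eq_one that by (metis restrict_apply')
    then show ?thesis using \<open>0 < e\<close> by auto
  qed
  ultimately obtain \<eta> where \<eta>: "0 < \<eta>" "mball \<one>\<^bsub>G\<^esub> \<eta> \<subseteq> carrier G - fst ` ?C"
    unfolding openin_mtopology by blast
  have "\<bar>f (\<phi> v y) - f y\<bar> < e" if "v \<in> carrier G" "d \<one>\<^bsub>G\<^esub> v < \<eta>" "y \<in> topspace K" for v y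
  proof (rule ccontr)
    assume "\<not> \<bar>f (\<phi> v y) - f y\<bar> < e"
    then have "(v, y) \<in> ?C" using that by auto
    then have "v \<in> fst ` ?C" by force
    moreover have "v \<in> mball \<one>\<^bsub>G\<^esub> \<eta>" using that by simp
    ultimately show False using \<eta>(2) by blast
  qed
  with \<eta>(1) show ?thesis by blast
qed

text \<open>A Levy property: finitely many group elements are approximated by elements acting diagonally
  by left translation on a finite power \<open>S ^ n\<close> mapped into \<open>G\<close>, on which functions that are
  Lipschitz for a weighted Hamming distance with small \<open>\<Sum>i<n. (w i)\<^sup>2\<close> concentrate.\<close>

definition levy_approximation ::
  "('g, 'm) monoid_scheme \<Rightarrow> ('g \<Rightarrow> 'g \<Rightarrow> real) \<Rightarrow> 'g set \<Rightarrow> real \<Rightarrow> 's set \<Rightarrow> nat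
    \<Rightarrow> ('s list \<Rightarrow> 'g) \<Rightarrow> (nat \<Rightarrow> real) \<Rightarrow> bool" where
  "levy_approximation G d F \<eta> S n \<Phi> w \<longleftrightarrow>
     finite S \<and> S \<noteq> {} \<and> (\<forall>i. 0 \<le> w i) \<and>
     (\<forall>xs. length xs = n \<and> set xs \<subseteq> S \<longrightarrow> \<Phi> xs \<in> carrier G) \<and>
     (\<forall>xs ys. length xs = n \<and> set xs \<subseteq> S \<and> length ys = n \<and> set ys \<subseteq> S
        \<longrightarrow> d (\<Phi> xs) (\<Phi> ys) \<le> hamming w xs ys) \<and>
     (\<forall>g\<in>F. \<exists>g'\<in>carrier G. \<exists>\<gamma>. bij_betw \<gamma> S S \<and> d g g' < \<eta> \<and>
        (\<forall>xs. length xs = n \<and> set xs \<subseteq> S \<longrightarrow> \<Phi> (map \<gamma> xs) = g' \<otimes>\<^bsub>G\<^esub> \<Phi> xs))"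

text \<open>Without a fixed point, compactness yields finitely many pairs \<open>(g, f)\<close> such
  that every point of \<open>K\<close> is moved visibly by one of them. The approximation produces a
  point \<open>\<phi> a x0\<close> that none of these pairs moves visibly.\<close>

lemma fixed_point_criterion:
  fixes K :: "'k topology"
  assumes metric: "Metric_space (carrier G) d" and "group G"
    and inv: "\<And>a b c. \<lbrakk>a \<in> carrier G; b \<in> carrier G; c \<in> carrier G\<rbrakk>
           \<Longrightarrow> d (a \<otimes>\<^bsub>G\<^esub> c) (b \<otimes>\<^bsub>G\<^esub> c) = d a b"
    and approx: "\<And>F \<eta> \<delta>. \<lbrakk>finite F; F \<subseteq> carrier G; 0 < \<eta>; 0 < \<delta>\<rbrakk> \<Longrightarrow>
        \<exists>(S::'s set) n \<Phi> w. levy_approximation G d F \<eta> S n \<Phi> w \<and> (\<Sum>i<n. (w i)\<^sup>2) < \<delta>"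
    and K: "compact_space K" "Hausdorff_space K" "topspace K \<noteq> {}"
    and act: "continuous_action G (Metric_space.mtopology (carrier G) d) K \<phi>"
  shows "\<exists>x\<in>topspace K. \<forall>g\<in>carrier G. \<phi> g x = x"
proof (rule ccontr)
  assume nofix: "\<not> (\<exists>x\<in>topspace K. \<forall>g\<in>carrier G. \<phi> g x = x)"
  interpret Metric_space "carrier G" d by fact
  interpret group G by fact
  interpret group_action G "topspace K" \<phi> using act unfolding continuous_action_def by blast
  have \<phi>_in: "\<phi> g x \<in> topspace K" if "g \<in> carrier G" "x \<in> topspace K" for g x
    using element_image that by blast
  have \<phi>_mult: "\<phi> (g \<otimes>\<^bsub>G\<^esub> h) x = \<phi> g (\<phi> h x)" if "g \<in> carrier G" "h \<in> carrier G" "x \<in> topspace K" for g h x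
    using composition_rule that by blast
  have \<phi>_cont: "continuous_map K K (\<phi> g)" if "g \<in> carrier G" for g
  proof -
    have "continuous_map K (prod_topology mtopology K) (\<lambda>x. (g, x))"
      using that by (intro continuous_map_pairedI) auto
    then have "continuous_map K K ((\<lambda>(g, x). \<phi> g x) \<circ> (\<lambda>x. (g, x)))"
      by (rule continuous_map_compose) (use act in \<open>simp add: continuous_action_def\<close>)
    then show ?thesis by (simp add: o_def)
  qed
  define Q where "Q = {(g, f). g \<in> carrier G \<and> continuous_map K (top_of_set {0..1::real}) f}"
  \<comment> \<open>An \<open>f\<close> separating \<open>x\<close> from \<open>\<phi> g x\<close>
    displaces by 1. The threshold 1/2 makes the sets open and leaves room for four errors of at most
    1/10 each.\<close>
  define V where "V = (\<lambda>(g, f). {y \<in> topspace K. \<bar>f (\<phi> g y) - f y\<bar> \<in> {1/2::real<..}})"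
  have V_open: "openin K (V p)" if "p \<in> Q" for p
  proof -
    obtain g f where "p = (g, f)" by (cases p)
    then have p: "p = (g, f)" "g \<in> carrier G" "continuous_map K euclideanreal f"
      using that by (auto simp: Q_def continuous_map_in_subtopology)
    have "continuous_map K euclideanreal (\<lambda>y. \<bar>f (\<phi> g y) - f y\<bar>)"
      using continuous_map_compose[OF \<phi>_cont[OF p(2)] p(3)] p(3)
      by (intro continuous_map_real_abs continuous_map_diff) (auto simp: o_def)
    then show ?thesis unfolding V_def p(1) prod.case
      by (rule openin_continuous_map_preimage) auto
  qed
  have cover: "\<exists>p\<in>Q. x \<in> V p" if x: "x \<in> topspace K" for x
  proof -
    obtain g where g: "g \<in> carrier G" "\<phi> g x \<noteq> x" using nofix x by blast
    have "closedin K {\<phi> g x}" using closedin_Hausdorff_singleton[OF K(2)] \<phi>_in g(1) x by blast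
    moreover have "completely_regular_space K"
      using K(1,2) compact_Hausdorff_or_regular_imp_normal_space normal_imp_completely_regular_space by blast
    moreover have "x \<in> topspace K - {\<phi> g x}" using g(2) x by auto
    ultimately obtain f where f: "continuous_map K (top_of_set {0..1::real}) f" "f x = 0" "f ` {\<phi> g x} \<subseteq> {1}"
      unfolding completely_regular_space_def by blast
    then have "(g, f) \<in> Q" "x \<in> V (g, f)" using g x f by (auto simp: Q_def V_def)
    then show ?thesis by blast
  qed
  then have "topspace K \<subseteq> \<Union>(V ` Q)" by blast
  moreover have "\<forall>U\<in>V ` Q. openin K U" using V_open by blast
  ultimately have "\<exists>\<F>. finite \<F> \<and> \<F> \<subseteq> V ` Q \<and> topspace K \<subseteq> \<Union>\<F>"
    using K(1) unfolding compact_space_alt by blast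
  then obtain P where P: "finite P" "P \<subseteq> Q" "topspace K \<subseteq> \<Union>(V ` P)"
    using finite_subset_image by metis
  obtain x0 where x0: "x0 \<in> topspace K" using K(3) by blast
  have "\<exists>\<eta>>0. \<forall>v\<in>carrier G. d \<one>\<^bsub>G\<^esub> v < \<eta> \<longrightarrow> (\<forall>y\<in>topspace K. \<bar>snd p (\<phi> v y) - snd p y\<bar> < 1/10)"
    if "p \<in> P" for p
  proof (rule continuous_action_uniform[OF metric \<open>group G\<close> act K(1)])
    show "continuous_map K euclideanreal (snd p)"
      using that P(2) by (auto simp: Q_def continuous_map_in_subtopology)
  qed simp
  then obtain H where H: "\<And>p. p \<in> P \<Longrightarrow> 0 < H p"
    "\<And>p v y. \<lbrakk>p \<in> P; v \<in> carrier G; d \<one>\<^bsub>G\<^esub> v < H p; y \<in> topspace K\<rbrakk> \<Longrightarrow> \<bar>snd p (\<phi> v y) - snd p y\<bar> < 1/10"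
    by metis
  \<comment> \<open>The inserted 1 keeps \<open>Min\<close> meaningful whatever \<open>P\<close>
    is.\<close>
  define \<eta> where "\<eta> = Min (insert 1 (H ` P))"
  have \<eta>: "0 < \<eta>" and \<eta>_le: "\<And>p. p \<in> P \<Longrightarrow> \<eta> \<le> H p"
    using H(1) P(1) by (auto simp: \<eta>_def)
  have unif: "\<bar>snd p (\<phi> a y) - snd p (\<phi> b y)\<bar> \<le> 1/10"
    if p: "p \<in> P" and a: "a \<in> carrier G" and b: "b \<in> carrier G" and ab: "d a b < \<eta>" and y: "y \<in> topspace K"
    for p a b y
  proof -
    have v: "a \<otimes>\<^bsub>G\<^esub> inv\<^bsub>G\<^esub> b \<in> carrier G" using a b by simp
    \<comment> \<open>Right invariance turns closeness of \<open>a\<close> and \<open>b\<close> into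
      closeness of their quotient to the identity; that quotient carries \<open>\<phi> b y\<close>
      to \<open>\<phi> a y\<close>.\<close>
    have "d \<one>\<^bsub>G\<^esub> (a \<otimes>\<^bsub>G\<^esub> inv\<^bsub>G\<^esub> b) = d (b \<otimes>\<^bsub>G\<^esub> inv\<^bsub>G\<^esub> b) (a \<otimes>\<^bsub>G\<^esub> inv\<^bsub>G\<^esub> b)" using b by simp
    also have "\<dots> = d a b" using inv[of b a "inv\<^bsub>G\<^esub> b"] a b by (simp add: commute)
    finally have "d \<one>\<^bsub>G\<^esub> (a \<otimes>\<^bsub>G\<^esub> inv\<^bsub>G\<^esub> b) < H p" using ab \<eta>_le[OF p] by simp
    from H(2)[OF p v this \<phi>_in[OF b y]]
    have "\<bar>snd p (\<phi> (a \<otimes>\<^bsub>G\<^esub> inv\<^bsub>G\<^esub> b) (\<phi> b y)) - snd p (\<phi> b y)\<bar> < 1/10" .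
    moreover have "\<phi> (a \<otimes>\<^bsub>G\<^esub> inv\<^bsub>G\<^esub> b) (\<phi> b y) = \<phi> a y"
      using \<phi>_mult[OF v b y] a b by (simp add: m_assoc)
    ultimately show ?thesis by simp
  qed
  have "\<exists>k. (\<forall>a\<in>carrier G. \<bar>k a - snd p (\<phi> a x0)\<bar> \<le> 1/10) \<and>
      (\<forall>a\<in>carrier G. \<forall>b\<in>carrier G. \<bar>k a - k b\<bar> \<le> d a b / \<eta>)" if p: "p \<in> P" for p
  proof (rule lipschitz_approximation[OF \<eta>])
    fix a assume "a \<in> carrier G"
    moreover have "p \<in> Q" using p P(2) by blast
    then have "snd p \<in> topspace K \<rightarrow> {0..1}"
      by (cases p) (simp add: Q_def continuous_map_in_subtopology image_subset_iff_funcset)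
    ultimately show "0 \<le> snd p (\<phi> a x0) \<and> snd p (\<phi> a x0) \<le> 1" using \<phi>_in[OF _ x0] by fastforce
  qed (use unif[OF p] x0 in auto)
  then obtain k where k: "\<And>p a. \<lbrakk>p \<in> P; a \<in> carrier G\<rbrakk> \<Longrightarrow> \<bar>k p a - snd p (\<phi> a x0)\<bar> \<le> 1/10"
    and k_lip: "\<And>p a b. \<lbrakk>p \<in> P; a \<in> carrier G; b \<in> carrier G\<rbrakk> \<Longrightarrow> \<bar>k p a - k p b\<bar> \<le> d a b / \<eta>"
    by metis
  \<comment> \<open>The functions are Lipschitz with constant \<open>1 / \<eta>\<close>, which
    divides the sum of squared weights by \<open>\<eta>\<^sup>2\<close>. The summand 1 beside
    \<open>card P\<close> keeps the denominator positive and makes the final inequality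
    strict.\<close>
  define \<delta> where "\<delta> = (1/10)\<^sup>2 * \<eta>\<^sup>2 / (4 * (1 + real (card P)))"
  have "0 < \<delta>" using \<eta> by (simp add: \<delta>_def)
  have "finite (fst ` P)" "fst ` P \<subseteq> carrier G" using P by (auto simp: Q_def)
  from approx[OF this \<eta> \<open>0 < \<delta>\<close>] obtain S :: "'s set" and n \<Phi> w where
    levy: "levy_approximation G d (fst ` P) \<eta> S n \<Phi> w" and w\<delta>: "(\<Sum>i<n. (w i)\<^sup>2) < \<delta>"
    by blast
  have S: "finite S" "S \<noteq> {}" and w: "\<And>i. 0 \<le> w i"
    and \<Phi>_in: "\<And>xs. \<lbrakk>length xs = n; set xs \<subseteq> S\<rbrakk> \<Longrightarrow> \<Phi> xs \<in> carrier G"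
    and \<Phi>_lip: "\<And>xs ys. \<lbrakk>length xs = n; set xs \<subseteq> S; length ys = n; set ys \<subseteq> S\<rbrakk> \<Longrightarrow> d (\<Phi> xs) (\<Phi> ys) \<le> hamming w xs ys"
    using levy unfolding levy_approximation_def by blast+
  have "\<forall>p\<in>P. \<exists>g' \<gamma>. g' \<in> carrier G \<and> bij_betw \<gamma> S S \<and> d (fst p) g' < \<eta> \<and>
             (\<forall>xs. length xs = n \<and> set xs \<subseteq> S \<longrightarrow> \<Phi> (map \<gamma> xs) = g' \<otimes>\<^bsub>G\<^esub> \<Phi> xs)"
    using levy unfolding levy_approximation_def by blast
  then obtain g' \<gamma> where g': "\<And>p. p \<in> P \<Longrightarrow> g' p \<in> carrier G" "\<And>p. p \<in> P \<Longrightarrow> d (fst p) (g' p) < \<eta>"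
    and \<gamma>: "\<And>p. p \<in> P \<Longrightarrow> bij_betw (\<gamma> p) S S"
    and \<Phi>_map: "\<And>p xs. \<lbrakk>p \<in> P; length xs = n; set xs \<subseteq> S\<rbrakk> \<Longrightarrow> \<Phi> (map (\<gamma> p) xs) = g' p \<otimes>\<^bsub>G\<^esub> \<Phi> xs"
    by metis
  have "\<exists>xs. length xs = n \<and> set xs \<subseteq> S \<and> (\<forall>p\<in>P. \<bar>k p (\<Phi> (map (\<gamma> p) xs)) - k p (\<Phi> xs)\<bar> < 1/10)"
  proof (rule exists_almost_invariant[where w = "\<lambda>i. w i / \<eta>"])
    fix p xs ys assume *: "p \<in> P" "length xs = n" "set xs \<subseteq> S" "length ys = n" "set ys \<subseteq> S"
    have "\<bar>k p (\<Phi> xs) - k p (\<Phi> ys)\<bar> \<le> d (\<Phi> xs) (\<Phi> ys) / \<eta>" using k_lip * \<Phi>_in by blast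
    also have "\<dots> \<le> hamming w xs ys / \<eta>" using \<Phi>_lip * \<eta> by (simp add: divide_right_mono)
    also have "\<dots> = hamming (\<lambda>i. w i / \<eta>) xs ys"
      by (auto simp: hamming_def sum_divide_distrib intro!: sum.cong)
    finally show "\<bar>k p (\<Phi> xs) - k p (\<Phi> ys)\<bar> \<le> hamming (\<lambda>i. w i / \<eta>) xs ys" .
  next
    have "(\<Sum>i<n. (w i / \<eta>)\<^sup>2) = (\<Sum>i<n. (w i)\<^sup>2) / \<eta>\<^sup>2"
      by (simp add: power_divide sum_divide_distrib)
    also have "\<dots> \<le> \<delta> / \<eta>\<^sup>2" using w\<delta> \<eta> by (simp add: divide_right_mono)
    also have "\<dots> = (1/10)\<^sup>2 / (4 * (1 + real (card P)))" using \<eta> by (simp add: \<delta>_def)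
    finally have "4 * real (card P) * (\<Sum>i<n. (w i / \<eta>)\<^sup>2) \<le> 4 * real (card P) * ((1/10)\<^sup>2 / (4 * (1 + real (card P))))"
      by (intro mult_left_mono) auto
    also have "\<dots> < (1/10)\<^sup>2" by (simp add: field_simps)
    finally show "4 * real (card P) * (\<Sum>i<n. (w i / \<eta>)\<^sup>2) < (1/10)\<^sup>2" .
  qed (use S P(1) \<gamma> w \<eta> in auto)
  then obtain xs where xs: "length xs = n" "set xs \<subseteq> S"
    and close: "\<And>p. p \<in> P \<Longrightarrow> \<bar>k p (g' p \<otimes>\<^bsub>G\<^esub> \<Phi> xs) - k p (\<Phi> xs)\<bar> < 1/10"
    using \<Phi>_map by metis
  define a where "a = \<Phi> xs"
  have a: "a \<in> carrier G" using \<Phi>_in xs by (simp add: a_def)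
  \<comment> \<open>Some pair of the cover displaces \<open>\<phi> a x0\<close> by more than 1/2.
    Yet four replacements cost less than 4/10 in total: \<open>g\<close> by \<open>g' p\<close>, the
    orbit function by \<open>k p\<close> at two places, and the almost invariance of
    \<open>k p\<close>.\<close>
  obtain p where p: "p \<in> P" "\<phi> a x0 \<in> V p" using P(3) \<phi>_in[OF a x0] by blast
  obtain g f where gf: "p = (g, f)" by (cases p)
  have g: "g \<in> carrier G" using p(1) P(2) gf by (auto simp: Q_def)
  have "1/2 < \<bar>f (\<phi> g (\<phi> a x0)) - f (\<phi> a x0)\<bar>" using p(2) by (simp add: gf V_def)
  moreover have "\<bar>f (\<phi> g (\<phi> a x0)) - f (\<phi> (g' p) (\<phi> a x0))\<bar> \<le> 1/10"
    using unif[OF p(1) g g'(1)[OF p(1)] _ \<phi>_in[OF a x0]] g'(2)[OF p(1)] by (simp add: gf)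
  moreover have "\<bar>k p (g' p \<otimes>\<^bsub>G\<^esub> a) - f (\<phi> (g' p) (\<phi> a x0))\<bar> \<le> 1/10"
    using k[OF p(1), of "g' p \<otimes>\<^bsub>G\<^esub> a"] g'(1)[OF p(1)] a \<phi>_mult[OF g'(1)[OF p(1)] a x0] by (simp add: gf)
  moreover have "\<bar>k p a - f (\<phi> a x0)\<bar> \<le> 1/10" using k[OF p(1) a] by (simp add: gf)
  ultimately show False using close[OF p(1)] unfolding a_def[symmetric] by linarith
qed

section \<open>Measure-preserving bijections\<close>

lemma mp_bijD:
  assumes "T \<in> mp_bij M"
  shows mp_bij_Bij: "T \<in> Bij (space M)"
    and mp_bij_bij: "bij_betw T (space M) (space M)"
    and mp_bij_ext: "T \<in> extensional (space M)"
    and mp_bij_measurable: "T \<in> M \<rightarrow>\<^sub>M M"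
    and mp_bij_inv_measurable: "inv_into (space M) T \<in> M \<rightarrow>\<^sub>M M"
    and mp_bij_distr: "distr M M T = M"
  using assms by (auto simp: mp_bij_def Bij_def)

lemma mp_bij_in_space: "T \<in> mp_bij M \<Longrightarrow> x \<in> space M \<Longrightarrow> T x \<in> space M"
  by (rule measurable_space[OF mp_bij_measurable])

lemma mp_bij_eqD: "T \<in> mp_bij M \<Longrightarrow> x \<in> space M \<Longrightarrow> y \<in> space M \<Longrightarrow> T x = T y \<Longrightarrow> x = y"
  using mp_bij_bij unfolding bij_betw_def by (metis inj_on_eq_iff)

lemma inv_into_vimage_bij_betw:
  assumes "bij_betw T S S" "B \<subseteq> S"
  shows "inv_into S T -` B \<inter> S = T ` B"
proof (intro equalityI subsetI)
  fix x assume "x \<in> inv_into S T -` B \<inter> S"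
  then show "x \<in> T ` B" using bij_betw_inv_into_right[OF assms(1), of x] by (metis IntE imageI vimageE)
next
  fix x assume "x \<in> T ` B"
  then obtain y where y: "y \<in> B" "x = T y" by blast
  then have "y \<in> S" using assms(2) by blast
  then show "x \<in> inv_into S T -` B \<inter> S"
    using bij_betw_inv_into_left[OF assms(1)] bij_betwE[OF assms(1)] y by simp
qed

lemma mp_bij_vimage:
  assumes "T \<in> mp_bij M" "A \<in> sets M"
  shows "emeasure M (T -` A \<inter> space M) = emeasure M A"
  using emeasure_distr[OF mp_bij_measurable[OF assms(1)] assms(2)] mp_bij_distr[OF assms(1)] by simp

lemma mp_bij_image:
  assumes "T \<in> mp_bij M" "A \<in> sets M"
  shows mp_bij_image_sets: "T ` A \<in> sets M"
    and mp_bij_image_emeasure: "emeasure M (T ` A) = emeasure M A"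
proof -
  have A: "A \<subseteq> space M" using sets.sets_into_space assms(2) by blast
  show *: "T ` A \<in> sets M"
    using measurable_sets[OF mp_bij_inv_measurable[OF assms(1)] assms(2)]
      inv_into_vimage_bij_betw[OF mp_bij_bij[OF assms(1)] A] by simp
  have "T -` (T ` A) \<inter> space M = A" using mp_bij_eqD[OF assms(1)] A by auto
  with mp_bij_vimage[OF assms(1) *] show "emeasure M (T ` A) = emeasure M A" by simp
qed

text \<open>Images rather than preimages are tested because the maps built below are glued from
  pieces whose images are known. Images of measurable sets also give measurability of the
  inverse.\<close>

lemma mp_bijI:
  assumes T: "T \<in> Bij (space M)" "T \<in> M \<rightarrow>\<^sub>M M"
    and im: "\<And>A. A \<in> sets M \<Longrightarrow> T ` A \<in> sets M \<and> emeasure M (T ` A) = emeasure M A"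
  shows "T \<in> mp_bij M"
proof -
  have bij: "bij_betw T (space M) (space M)" using T by (simp add: Bij_def)
  have "inv_into (space M) T \<in> M \<rightarrow>\<^sub>M M"
  proof (rule measurableI)
    fix A assume A: "A \<in> sets M"
    then have "A \<subseteq> space M" by (rule sets.sets_into_space)
    then show "inv_into (space M) T -` A \<inter> space M \<in> sets M"
      using inv_into_vimage_bij_betw[OF bij] im[OF A] by simp
  qed (use bij in \<open>simp add: bij_betw_def inv_into_into\<close>)
  moreover have "distr M M T = M"
  proof (rule measure_eqI)
    fix A assume "A \<in> sets (distr M M T)"
    then have A: "A \<in> sets M" by simp
    have "T ` (T -` A \<inter> space M) = A \<inter> T ` space M" by auto
    then have "T ` (T -` A \<inter> space M) = A"
      using bij sets.sets_into_space[OF A] unfolding bij_betw_def by auto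
    then show "emeasure (distr M M T) A = emeasure M A"
      using im[OF measurable_sets[OF T(2) A]] A T(2) by (simp add: emeasure_distr)
  qed simp
  ultimately show ?thesis using T by (simp add: mp_bij_def)
qed

text \<open>A set is cut along the level sets of \<open>idx\<close>; on each piece \<open>T\<close>
  is a measure-preserving map, and by injectivity of \<open>T\<close> the images of the pieces are
  disjoint, so countable additivity applies. Both the closing-up of chains and the block maps are of
  this kind.\<close>

lemma mp_bij_piecewise:
  fixes idx :: "'a \<Rightarrow> nat"
  assumes T: "T \<in> Bij (space M)"
    and idx: "idx \<in> M \<rightarrow>\<^sub>M count_space UNIV"
    and F: "\<And>i. F i \<in> mp_bij M"
    and eq: "\<And>x. x \<in> space M \<Longrightarrow> T x = F (idx x) x"
  shows "T \<in> mp_bij M"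
proof (rule mp_bijI[OF T])
  have "(\<lambda>x. F (idx x) x) \<in> M \<rightarrow>\<^sub>M M"
    by (rule measurable_compose_countable[OF mp_bij_measurable[OF F] idx])
  then show "T \<in> M \<rightarrow>\<^sub>M M" by (subst measurable_cong[OF eq])
  fix A assume A: "A \<in> sets M"
  then have As: "A \<subseteq> space M" by (rule sets.sets_into_space)
  define P where "P i = A \<inter> (idx -` {i} \<inter> space M)" for i
  have P: "P i \<in> sets M" for i
    unfolding P_def using A measurable_sets[OF idx, of "{i}"] by auto
  have TP: "T ` P i = F i ` P i" for i by (rule image_cong) (auto simp: P_def eq)
  have "A = (\<Union>i. P i)" using As by (auto simp: P_def)
  then have TA: "T ` A = (\<Union>i. F i ` P i)" unfolding TP[symmetric] by blast
  have disjP: "disjoint_family P" by (auto simp: disjoint_family_on_def P_def)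
  have "inj_on T (space M)" using T by (simp add: Bij_def bij_betw_def)
  then have disjT: "disjoint_family (\<lambda>i. F i ` P i)"
    unfolding TP[symmetric] by (auto simp: disjoint_family_on_def P_def inj_on_def)
  have "emeasure M (T ` A) = (\<Sum>i. emeasure M (F i ` P i))"
    unfolding TA by (rule suminf_emeasure[symmetric]) (use mp_bij_image_sets[OF F P] disjT in auto)
  also have "\<dots> = (\<Sum>i. emeasure M (P i))" using mp_bij_image_emeasure[OF F P] by simp
  also have "\<dots> = emeasure M A"
    using suminf_emeasure[OF _ disjP, of M] P \<open>A = (\<Union>i. P i)\<close> by auto
  finally show "T ` A \<in> sets M \<and> emeasure M (T ` A) = emeasure M A"
    unfolding TA using mp_bij_image_sets[OF F P] by auto
qed

lemma mp_bij_id: "(\<lambda>x\<in>space M. x) \<in> mp_bij M"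
proof (rule mp_bijI[OF id_Bij])
  show "(\<lambda>x\<in>space M. x) \<in> M \<rightarrow>\<^sub>M M" by (subst measurable_cong[where g = "\<lambda>x. x"]) auto
  fix A assume A: "A \<in> sets M"
  then have "(\<lambda>x\<in>space M. x) ` A = A" using sets.sets_into_space[OF A] by (force simp: image_iff)
  with A show "(\<lambda>x\<in>space M. x) ` A \<in> sets M \<and> emeasure M ((\<lambda>x\<in>space M. x) ` A) = emeasure M A" by simp
qed

lemma mp_bij_compose:
  assumes "S \<in> mp_bij M" "T \<in> mp_bij M"
  shows "compose (space M) S T \<in> mp_bij M"
proof (rule mp_bijI)
  show "compose (space M) S T \<in> Bij (space M)" using assms by (intro compose_Bij mp_bij_Bij)
  have "(\<lambda>x. S (T x)) \<in> M \<rightarrow>\<^sub>M M"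
    using measurable_compose[OF mp_bij_measurable mp_bij_measurable] assms by blast
  then show "compose (space M) S T \<in> M \<rightarrow>\<^sub>M M"
    by (subst measurable_cong[where g = "\<lambda>x. S (T x)"]) (auto simp: compose_def)
  fix A assume A: "A \<in> sets M"
  have "compose (space M) S T ` A = S ` T ` A"
    using sets.sets_into_space[OF A] by (force simp: compose_def image_iff)
  then show "compose (space M) S T ` A \<in> sets M \<and> emeasure M (compose (space M) S T ` A) = emeasure M A"
    using mp_bij_image[OF assms(1)] mp_bij_image[OF assms(2) A] by auto
qed

lemma mp_bij_inv:
  assumes T: "T \<in> mp_bij M"
  shows "(\<lambda>x\<in>space M. inv_into (space M) T x) \<in> mp_bij M"
proof (rule mp_bijI)
  show "(\<lambda>x\<in>space M. inv_into (space M) T x) \<in> Bij (space M)"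
    using mp_bij_Bij[OF T] by (rule restrict_inv_into_Bij)
  show "(\<lambda>x\<in>space M. inv_into (space M) T x) \<in> M \<rightarrow>\<^sub>M M"
    using mp_bij_inv_measurable[OF T] by (subst measurable_cong[where g = "inv_into (space M) T"]) auto
  fix A assume A: "A \<in> sets M"
  then have As: "A \<subseteq> space M" by (rule sets.sets_into_space)
  have "(\<lambda>x\<in>space M. inv_into (space M) T x) ` A = inv_into (space M) T ` A"
    using As by (intro image_cong) auto
  also have "\<dots> = T -` A \<inter> space M"
  proof -
    have "x \<in> inv_into (space M) T ` A" if "x \<in> space M" "T x \<in> A" for x
      using bij_betw_inv_into_left[OF mp_bij_bij[OF T] that(1)] that(2) by (metis imageI)
    moreover have "T (inv_into (space M) T y) = y \<and> inv_into (space M) T y \<in> space M" if "y \<in> A" for y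
      using bij_betw_inv_into_right[OF mp_bij_bij[OF T]] mp_bij_bij[OF T] that As
      by (metis bij_betw_def inv_into_into subsetD)
    ultimately show ?thesis by auto
  qed
  finally show "(\<lambda>x\<in>space M. inv_into (space M) T x) ` A \<in> sets M
      \<and> emeasure M ((\<lambda>x\<in>space M. inv_into (space M) T x) ` A) = emeasure M A"
    using measurable_sets[OF mp_bij_measurable[OF T] A] mp_bij_vimage[OF T A] by simp
qed

lemma AE_mp_bij:
  assumes "T \<in> mp_bij M" "AE x in M. P x"
  shows "AE x in M. P (T x)"
proof -
  have "AE x in distr M M T. P x" unfolding mp_bij_distr[OF assms(1)] by (rule assms(2))
  then show ?thesis by (rule AE_distrD[OF mp_bij_measurable[OF assms(1)]])
qed

text \<open>The substitution of the inverse of \<open>T\<close> for \<open>x\<close>. The two-place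
  \<open>P\<close> covers both equality of maps and membership in an equivalence relation.\<close>

lemma AE_mp_bij_inv:
  assumes "T \<in> mp_bij M" "AE x in M. P (T x) x"
  shows "AE x in M. P x (inv_into (space M) T x)"
proof -
  have "AE x in M. P (T ((\<lambda>x\<in>space M. inv_into (space M) T x) x)) ((\<lambda>x\<in>space M. inv_into (space M) T x) x)"
    by (rule AE_mp_bij[OF mp_bij_inv[OF assms(1)] assms(2)])
  then show ?thesis
    using AE_space by eventually_elim (simp add: bij_betw_inv_into_right[OF mp_bij_bij[OF assms(1)]])
qed

section \<open>The group of measure-preserving bijections and its normal subgroup of null
  modifications of the identity\<close>

abbreviation mp_group :: "'a measure \<Rightarrow> ('a \<Rightarrow> 'a) monoid" where
  "mp_group M \<equiv> BijGroup (space M)\<lparr>carrier := mp_bij M\<rparr>"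

lemma mp_group_mult:
  assumes "S \<in> mp_bij M" "T \<in> mp_bij M"
  shows "S \<otimes>\<^bsub>BijGroup (space M)\<^esub> T = compose (space M) S T"
  using assms by (simp add: BijGroup_def mp_bij_Bij)

lemma subgroup_mp_bij: "subgroup (mp_bij M) (BijGroup (space M))"
proof (rule group.subgroupI[OF group_BijGroup])
  show "mp_bij M \<subseteq> carrier (BijGroup (space M))" by (auto simp: BijGroup_def mp_bij_Bij)
  show "mp_bij M \<noteq> {}" using mp_bij_id by blast
  show "inv\<^bsub>BijGroup (space M)\<^esub> T \<in> mp_bij M" if "T \<in> mp_bij M" for T
    using that mp_bij_inv by (simp add: inv_BijGroup mp_bij_Bij)
  show "S \<otimes>\<^bsub>BijGroup (space M)\<^esub> T \<in> mp_bij M" if "S \<in> mp_bij M" "T \<in> mp_bij M" for S T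
    using that mp_bij_compose by (simp add: BijGroup_def mp_bij_Bij)
qed

lemma group_mp_group: "group (mp_group M)"
  by (rule subgroup.subgroup_is_group[OF subgroup_mp_bij group_BijGroup])

lemma mp_group_inv:
  assumes "T \<in> mp_bij M"
  shows "inv\<^bsub>mp_group M\<^esub> T = (\<lambda>x\<in>space M. inv_into (space M) T x)"
  using group.m_inv_consistent[OF group_BijGroup subgroup_mp_bij assms] assms
  by (simp add: inv_BijGroup mp_bij_Bij)

lemma normal_ae_identity: "ae_identity M \<lhd> mp_group M"
proof -
  interpret group "mp_group M" by (rule group_mp_group)
  show ?thesis
  proof (rule normal_invI)
    show "subgroup (ae_identity M) (mp_group M)"
    proof (rule subgroupI)
      show "ae_identity M \<subseteq> carrier (mp_group M)" by (auto simp: ae_identity_def)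
      have "(\<lambda>x\<in>space M. x) \<in> ae_identity M" using AE_space by (auto simp: ae_identity_def mp_bij_id)
      then show "ae_identity M \<noteq> {}" by blast
    next
      fix T assume "T \<in> ae_identity M"
      then have T: "T \<in> mp_bij M" "AE x in M. T x = x" by (auto simp: ae_identity_def)
      have "AE x in M. inv_into (space M) T x = x"
        using AE_mp_bij_inv[OF T(1), of "\<lambda>a b. a = b"] T(2) by (simp add: eq_commute)
      then have "AE x in M. (\<lambda>x\<in>space M. inv_into (space M) T x) x = x"
        using AE_space by eventually_elim simp
      then show "inv\<^bsub>mp_group M\<^esub> T \<in> ae_identity M"
        using mp_bij_inv[OF T(1)] by (simp add: mp_group_inv[OF T(1)] ae_identity_def)
    next
      fix S T assume "S \<in> ae_identity M" "T \<in> ae_identity M"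
      then have S: "S \<in> mp_bij M" "AE x in M. S x = x" and T: "T \<in> mp_bij M" "AE x in M. T x = x"
        by (auto simp: ae_identity_def)
      have "AE x in M. compose (space M) S T x = x"
        using S(2) T(2) AE_space by eventually_elim (simp add: compose_def)
      then show "S \<otimes>\<^bsub>mp_group M\<^esub> T \<in> ae_identity M"
        using S T by (simp add: mp_group_mult[OF S(1) T(1)] ae_identity_def mp_bij_compose)
    qed
  next
    fix T N assume "T \<in> carrier (mp_group M)" "N \<in> ae_identity M"
    then have T: "T \<in> mp_bij M" and N: "N \<in> mp_bij M" "AE x in M. N x = x" by (auto simp: ae_identity_def)
    define I where "I = (\<lambda>x\<in>space M. inv_into (space M) T x)"
    have I: "I \<in> mp_bij M" unfolding I_def by (rule mp_bij_inv[OF T])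
    have TI: "T (I x) = x" if "x \<in> space M" for x
      using that bij_betw_inv_into_right[OF mp_bij_bij[OF T]] by (simp add: I_def)
    \<comment> \<open>The conjugate fixes \<open>x\<close> as soon as \<open>N\<close> fixes
      \<open>I x\<close>, and \<open>I\<close> preserves null sets.\<close>
    have "AE x in M. N (I x) = I x" using AE_mp_bij[OF I N(2)] .
    then have "AE x in M. compose (space M) (compose (space M) T N) I x = x"
      using AE_space
    proof eventually_elim
      case (elim x)
      then show ?case using TI mp_bij_in_space[OF I] by (simp add: compose_def)
    qed
    then have "compose (space M) (compose (space M) T N) I \<in> ae_identity M"
      using mp_bij_compose[OF mp_bij_compose[OF T N(1)] I] by (simp add: ae_identity_def)
    then show "T \<otimes>\<^bsub>mp_group M\<^esub> N \<otimes>\<^bsub>mp_group M\<^esub> inv\<^bsub>mp_group M\<^esub> T \<in> ae_identity M"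
      by (simp add: mp_group_inv[OF T, folded I_def] mp_group_mult T N I mp_bij_compose)
  qed
qed

section \<open>Full groups\<close>

text \<open>The elements of \<open>Aut M\<close> in usable form, as classes of almost-everywhere
  equality. The representative may be any function, which allows the unrestricted identity in the
  computation of the unit.\<close>

definition coset :: "'a measure \<Rightarrow> ('a \<Rightarrow> 'a) \<Rightarrow> ('a \<Rightarrow> 'a) set" where
  "coset M T = {T' \<in> mp_bij M. AE x in M. T' x = T x}"

lemma coset_eq_r_coset:
  assumes T: "T \<in> mp_bij M"
  shows "ae_identity M #>\<^bsub>BijGroup (space M)\<^esub> T = coset M T"
proof
  show "ae_identity M #>\<^bsub>BijGroup (space M)\<^esub> T \<subseteq> coset M T"
  proof
    fix U assume "U \<in> ae_identity M #>\<^bsub>BijGroup (space M)\<^esub> T"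
    then obtain N where N: "N \<in> mp_bij M" "AE x in M. N x = x" "U = compose (space M) N T"
      using mp_group_mult[OF _ T] by (auto simp: r_coset_def ae_identity_def)
    have "AE x in M. U x = T x"
      using AE_mp_bij[OF T N(2)] AE_space by eventually_elim (simp add: N(3) compose_def)
    then show "U \<in> coset M T" using N T by (simp add: coset_def mp_bij_compose)
  qed
  show "coset M T \<subseteq> ae_identity M #>\<^bsub>BijGroup (space M)\<^esub> T"
  proof
    fix U assume "U \<in> coset M T"
    then have U: "U \<in> mp_bij M" "AE x in M. U x = T x" by (auto simp: coset_def)
    let ?I = "\<lambda>x\<in>space M. inv_into (space M) T x"
    have I: "?I \<in> mp_bij M" by (rule mp_bij_inv[OF T])
    have "AE x in M. U (inv_into (space M) T x) = x"
      using AE_mp_bij_inv[OF T, of "\<lambda>y x. U x = y"] U(2) by simp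
    then have "AE x in M. compose (space M) U ?I x = x"
      using AE_space by eventually_elim (simp add: compose_def)
    then have I_id: "compose (space M) U ?I \<in> ae_identity M"
      using mp_bij_compose[OF U(1) I] by (simp add: ae_identity_def)
    have "compose (space M) (compose (space M) U ?I) T = compose (space M) U (compose (space M) ?I T)"
      by (rule compose_assoc[symmetric]) (use mp_bij_in_space[OF T] in auto)
    also have "\<dots> = U"
      unfolding Bij_compose_restrict_eq[OF mp_bij_Bij[OF T]]
      by (rule compose_Id[OF _ mp_bij_ext[OF U(1)]]) (use mp_bij_in_space[OF U(1)] in auto)
    finally have "compose (space M) (compose (space M) U ?I) T = U" .
    then have "U = compose (space M) U ?I \<otimes>\<^bsub>BijGroup (space M)\<^esub> T"
      using mp_group_mult[OF mp_bij_compose[OF U(1) I] T] by simp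
    with I_id show "U \<in> ae_identity M #>\<^bsub>BijGroup (space M)\<^esub> T" unfolding r_coset_def by blast
  qed
qed

lemma coset_self: "T \<in> mp_bij M \<Longrightarrow> T \<in> coset M T"
  by (simp add: coset_def)

lemma coset_cong: "AE x in M. S x = T x \<Longrightarrow> coset M S = coset M T"
proof -
  assume eq: "AE x in M. S x = T x"
  have "(AE x in M. U x = S x) \<longleftrightarrow> (AE x in M. U x = T x)" for U
  proof
    assume "AE x in M. U x = S x"
    with eq show "AE x in M. U x = T x" by eventually_elim simp
  next
    assume "AE x in M. U x = T x"
    with eq show "AE x in M. U x = S x" by eventually_elim simp
  qed
  then show ?thesis by (simp add: coset_def)
qed

lemma carrier_Aut: "carrier (Aut M) = coset M ` mp_bij M"
  unfolding Aut_def carrier_FactGroup using coset_eq_r_coset by (auto simp: image_iff)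

lemma group_Aut: "group (Aut M)"
  unfolding Aut_def by (rule normal.factorgroup_is_group[OF normal_ae_identity])

lemma Aut_mult:
  assumes "S \<in> mp_bij M" "T \<in> mp_bij M"
  shows "coset M S \<otimes>\<^bsub>Aut M\<^esub> coset M T = coset M (compose (space M) S T)"
proof -
  have "(ae_identity M #>\<^bsub>mp_group M\<^esub> S) <#>\<^bsub>mp_group M\<^esub> (ae_identity M #>\<^bsub>mp_group M\<^esub> T)
      = ae_identity M #>\<^bsub>mp_group M\<^esub> (S \<otimes>\<^bsub>mp_group M\<^esub> T)"
    by (rule normal.rcos_sum[OF normal_ae_identity]) (use assms in auto)
  then show ?thesis
    using assms by (simp add: Aut_def coset_eq_r_coset mp_group_mult mp_bij_compose)
qed

lemma Aut_one: "\<one>\<^bsub>Aut M\<^esub> = coset M (\<lambda>x\<in>space M. x)"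
proof -
  have "\<one>\<^bsub>Aut M\<^esub> = ae_identity M" by (simp add: Aut_def)
  also have "\<dots> = coset M (\<lambda>x. x)" by (simp add: ae_identity_def coset_def)
  also have "\<dots> = coset M (\<lambda>x\<in>space M. x)" by (rule coset_cong) (use AE_space in \<open>eventually_elim, simp\<close>)
  finally show ?thesis .
qed

lemma Aut_inv:
  assumes T: "T \<in> mp_bij M"
  shows "inv\<^bsub>Aut M\<^esub> (coset M T) = coset M (\<lambda>x\<in>space M. inv_into (space M) T x)"
proof (rule group.inv_equality[OF group_Aut])
  let ?I = "\<lambda>x\<in>space M. inv_into (space M) T x"
  have I: "?I \<in> mp_bij M" by (rule mp_bij_inv[OF T])
  show "coset M ?I \<otimes>\<^bsub>Aut M\<^esub> coset M T = \<one>\<^bsub>Aut M\<^esub>"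
    unfolding Aut_mult[OF I T] Aut_one Bij_compose_restrict_eq[OF mp_bij_Bij[OF T]] ..
  show "coset M T \<in> carrier (Aut M)" "coset M ?I \<in> carrier (Aut M)"
    unfolding carrier_Aut using T I by (blast intro: imageI)+
qed

text \<open>For a bi-invariant metric, multiplication is 1-Lipschitz for the sum metric on pairs and
  inversion is an isometry.\<close>

lemma topological_group_mtopology:
  assumes "group G" "Metric_space (carrier G) d"
    and right: "\<And>a b c. \<lbrakk>a \<in> carrier G; b \<in> carrier G; c \<in> carrier G\<rbrakk>
           \<Longrightarrow> d (a \<otimes>\<^bsub>G\<^esub> c) (b \<otimes>\<^bsub>G\<^esub> c) = d a b"
    and left: "\<And>a b c. \<lbrakk>a \<in> carrier G; b \<in> carrier G; c \<in> carrier G\<rbrakk>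
           \<Longrightarrow> d (c \<otimes>\<^bsub>G\<^esub> a) (c \<otimes>\<^bsub>G\<^esub> b) = d a b"
  shows "topological_group G (Metric_space.mtopology (carrier G) d)"
proof -
  interpret group G by fact
  interpret Metric_space "carrier G" d by fact
  have "continuous_map (prod_topology mtopology mtopology) mtopology (\<lambda>(g, h). g \<otimes>\<^bsub>G\<^esub> h)"
    unfolding continuous_map_to_metric
  proof (intro ballI allI impI)
    fix p and e :: real assume p: "p \<in> topspace (prod_topology mtopology mtopology)" and "0 < e"
    obtain a b where ab: "p = (a, b)" "a \<in> carrier G" "b \<in> carrier G" using p by auto
    let ?U = "mball a (e/2) \<times> mball b (e/2)"
    have "openin (prod_topology mtopology mtopology) ?U" by (simp add: openin_prod_Times_iff)
    moreover have "p \<in> ?U" using ab \<open>0 < e\<close> by simp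
    moreover have "(case q of (g, h) \<Rightarrow> g \<otimes>\<^bsub>G\<^esub> h) \<in> mball (case p of (g, h) \<Rightarrow> g \<otimes>\<^bsub>G\<^esub> h) e" if q: "q \<in> ?U" for q
    proof -
      obtain g h where gh: "q = (g, h)" "g \<in> carrier G" "h \<in> carrier G" "d a g < e/2" "d b h < e/2"
        using q by auto
      have "d (a \<otimes>\<^bsub>G\<^esub> b) (g \<otimes>\<^bsub>G\<^esub> h) \<le> d (a \<otimes>\<^bsub>G\<^esub> b) (g \<otimes>\<^bsub>G\<^esub> b) + d (g \<otimes>\<^bsub>G\<^esub> b) (g \<otimes>\<^bsub>G\<^esub> h)"
        by (rule triangle) (use ab gh in auto)
      also have "\<dots> = d a g + d b h" using ab gh by (simp add: right left)
      finally show ?thesis using ab gh by auto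
    qed
    ultimately show "\<exists>U. openin (prod_topology mtopology mtopology) U \<and> p \<in> U \<and>
        (\<forall>q\<in>U. (case q of (g, h) \<Rightarrow> g \<otimes>\<^bsub>G\<^esub> h) \<in> mball (case p of (g, h) \<Rightarrow> g \<otimes>\<^bsub>G\<^esub> h) e)" by blast
  qed
  moreover have d_inv: "d (inv\<^bsub>G\<^esub> a) (inv\<^bsub>G\<^esub> b) = d a b" if ab: "a \<in> carrier G" "b \<in> carrier G" for a b
  proof -
    have "d (inv\<^bsub>G\<^esub> a) (inv\<^bsub>G\<^esub> b) = d (a \<otimes>\<^bsub>G\<^esub> inv\<^bsub>G\<^esub> a) (a \<otimes>\<^bsub>G\<^esub> inv\<^bsub>G\<^esub> b)"
      by (rule left[symmetric]) (use ab in auto)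
    also have "\<dots> = d (b \<otimes>\<^bsub>G\<^esub> inv\<^bsub>G\<^esub> b) (a \<otimes>\<^bsub>G\<^esub> inv\<^bsub>G\<^esub> b)" using ab by simp
    also have "\<dots> = d b a" using ab by (intro right) auto
    finally show ?thesis by (simp add: commute)
  qed
  have "continuous_map mtopology mtopology (\<lambda>g. inv\<^bsub>G\<^esub> g)"
    unfolding continuous_map_to_metric
  proof (intro ballI allI impI)
    fix a and e :: real assume a: "a \<in> topspace mtopology" and "0 < e"
    then have "a \<in> mball a e" "\<forall>b\<in>mball a e. inv\<^bsub>G\<^esub> b \<in> mball (inv\<^bsub>G\<^esub> a) e"
      using d_inv by auto
    then show "\<exists>U. openin mtopology U \<and> a \<in> U \<and> (\<forall>b\<in>U. inv\<^bsub>G\<^esub> b \<in> mball (inv\<^bsub>G\<^esub> a) e)"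
      using openin_mball by blast
  qed
  ultimately show ?thesis using \<open>group G\<close> by (simp add: topological_group_def)
qed

text \<open>In a second countable Hausdorff space, two points differ iff some member of a countable
  base contains the first and omits the second; so the complement of the set is a countable union of
  measurable sets.\<close>

lemma sets_eq_points:
  assumes "standard_borel M" "f \<in> N \<rightarrow>\<^sub>M M" "g \<in> N \<rightarrow>\<^sub>M M"
  shows "{x \<in> space N. f x = g x} \<in> sets N"
proof -
  obtain S where S: "topspace S = space M" "completely_metrizable_space S" "second_countable S"
    "sets M = sigma_sets (space M) {U. openin S U}"
    using assms(1) unfolding standard_borel_def by blast
  have H: "Hausdorff_space S"
    using S(2) completely_metrizable_imp_metrizable_space metrizable_imp_Hausdorff_space by blast
  obtain \<B> where B: "countable \<B>" "\<And>V. V \<in> \<B> \<Longrightarrow> openin S V"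
    "\<And>U x. \<lbrakk>openin S U; x \<in> U\<rbrakk> \<Longrightarrow> \<exists>V\<in>\<B>. x \<in> V \<and> V \<subseteq> U"
    using S(3) unfolding second_countable_def by metis
  have Vm: "V \<in> sets M" if "V \<in> \<B>" for V using B(2)[OF that] S(4) by auto
  have "{x \<in> space N. f x = g x} = space N - (\<Union>V\<in>\<B>. (f -` V \<inter> space N) - (g -` V \<inter> space N))"
  proof (intro equalityI subsetI)
    fix x assume x: "x \<in> space N - (\<Union>V\<in>\<B>. (f -` V \<inter> space N) - (g -` V \<inter> space N))"
    have "f x = g x"
    proof (rule ccontr)
      assume "f x \<noteq> g x"
      moreover have "f x \<in> topspace S" "g x \<in> topspace S"
        using x measurable_space[OF assms(2)] measurable_space[OF assms(3)] S(1) by auto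
      ultimately obtain U W where "openin S U" "openin S W" "f x \<in> U" "g x \<in> W" "disjnt U W"
        using H unfolding Hausdorff_space_def by blast
      then obtain V where "V \<in> \<B>" "f x \<in> V" "g x \<notin> V" using B(3)[of U "f x"] unfolding disjnt_def by blast
      then show False using x by auto
    qed
    with x show "x \<in> {x \<in> space N. f x = g x}" by auto
  qed auto
  also have "\<dots> \<in> sets N"
    using B(1) Vm measurable_sets[OF assms(2)] measurable_sets[OF assms(3)]
    by (intro sets.Diff sets.top sets.countable_UN') auto
  finally show ?thesis .
qed

section \<open>The uniform metric on automorphisms and on full groups\<close>

locale standard_prob = prob_space M for M :: "'a measure" +
  assumes standard: "standard_borel M"
begin

lemma eq_measurable [measurable]:
  "S \<in> mp_bij M \<Longrightarrow> T \<in> mp_bij M \<Longrightarrow> {x \<in> space M. S x = T x} \<in> sets M"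
  by (rule sets_eq_points[OF standard mp_bij_measurable mp_bij_measurable])

lemma neq_measurable:
  assumes "S \<in> mp_bij M" "T \<in> mp_bij M"
  shows "{x \<in> space M. S x \<noteq> T x} \<in> sets M"
proof -
  have "{x \<in> space M. S x \<noteq> T x} = space M - {x \<in> space M. S x = T x}" by auto
  then show ?thesis using eq_measurable[OF assms] by auto
qed

text \<open>Replaces the chosen representatives in the metric by arbitrary ones; subsequent
  computations of distances between cosets rest on it.\<close>

lemma uniform_dist_coset:
  assumes S: "S \<in> mp_bij M" and T: "T \<in> mp_bij M"
  shows "uniform_dist M (coset M S) (coset M T) = prob {x \<in> space M. S x \<noteq> T x}"
proof -
  define S' T' where "S' = (SOME U. U \<in> coset M S)" and "T' = (SOME U. U \<in> coset M T)"
  have "S' \<in> coset M S" unfolding S'_def by (rule someI[where P = "\<lambda>U. U \<in> coset M S"]) (rule coset_self[OF S])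
  then have S': "S' \<in> mp_bij M" "AE x in M. S' x = S x" by (auto simp: coset_def)
  have "T' \<in> coset M T" unfolding T'_def by (rule someI[where P = "\<lambda>U. U \<in> coset M T"]) (rule coset_self[OF T])
  then have T': "T' \<in> mp_bij M" "AE x in M. T' x = T x" by (auto simp: coset_def)
  have "prob {x \<in> space M. S' x \<noteq> T' x} = prob {x \<in> space M. S x \<noteq> T x}"
  proof (rule measure_eq_AE)
    show "AE x in M. (x \<in> {x \<in> space M. S' x \<noteq> T' x}) = (x \<in> {x \<in> space M. S x \<noteq> T x})"
      using S'(2) T'(2) by eventually_elim simp
  qed (use neq_measurable S T S' T' in auto)
  then show ?thesis unfolding uniform_dist_def S'_def T'_def .
qed

lemma uniform_dist_eq_0:
  assumes S: "S \<in> mp_bij M" and T: "T \<in> mp_bij M"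
  shows "uniform_dist M (coset M S) (coset M T) = 0 \<longleftrightarrow> coset M S = coset M T"
proof
  assume "uniform_dist M (coset M S) (coset M T) = 0"
  then have "emeasure M {x \<in> space M. S x \<noteq> T x} = 0"
    by (simp add: uniform_dist_coset[OF S T] emeasure_eq_measure)
  then have "AE x in M. S x = T x"
    using neq_measurable[OF S T] by (subst AE_iff_measurable[OF _ refl]) auto
  then show "coset M S = coset M T" by (rule coset_cong)
next
  assume "coset M S = coset M T"
  then have "uniform_dist M (coset M S) (coset M T) = uniform_dist M (coset M S) (coset M S)" by simp
  then show "uniform_dist M (coset M S) (coset M T) = 0" by (simp add: uniform_dist_coset[OF S S])
qed

lemma uniform_dist_triangle:
  assumes S: "S \<in> mp_bij M" and T: "T \<in> mp_bij M" and U: "U \<in> mp_bij M"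
  shows "uniform_dist M (coset M S) (coset M U)
       \<le> uniform_dist M (coset M S) (coset M T) + uniform_dist M (coset M T) (coset M U)"
proof -
  have "prob {x \<in> space M. S x \<noteq> U x} \<le> prob ({x \<in> space M. S x \<noteq> T x} \<union> {x \<in> space M. T x \<noteq> U x})"
    by (rule finite_measure_mono) (use neq_measurable S T U in auto)
  also have "\<dots> \<le> prob {x \<in> space M. S x \<noteq> T x} + prob {x \<in> space M. T x \<noteq> U x}"
    by (rule measure_Un_le) (use neq_measurable S T U in auto)
  finally show ?thesis by (simp add: uniform_dist_coset S T U)
qed

text \<open>The set where the two products differ is the preimage under \<open>U\<close> of the set
  where \<open>S\<close> and \<open>T\<close> differ.\<close>

lemma uniform_dist_right:
  assumes S: "S \<in> mp_bij M" and T: "T \<in> mp_bij M" and U: "U \<in> mp_bij M"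
  shows "uniform_dist M (coset M S \<otimes>\<^bsub>Aut M\<^esub> coset M U) (coset M T \<otimes>\<^bsub>Aut M\<^esub> coset M U)
       = uniform_dist M (coset M S) (coset M T)"
proof -
  let ?A = "{x \<in> space M. S x \<noteq> T x}"
  have "{x \<in> space M. compose (space M) S U x \<noteq> compose (space M) T U x} = U -` ?A \<inter> space M"
    using mp_bij_in_space[OF U] by (auto simp: compose_eq)
  moreover have "prob (U -` ?A \<inter> space M) = prob ?A"
    using mp_bij_vimage[OF U neq_measurable[OF S T]] by (simp add: measure_def)
  ultimately show ?thesis
    by (simp add: Aut_mult S T U uniform_dist_coset mp_bij_compose)
qed

lemma uniform_dist_left:
  assumes S: "S \<in> mp_bij M" and T: "T \<in> mp_bij M" and U: "U \<in> mp_bij M"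
  shows "uniform_dist M (coset M U \<otimes>\<^bsub>Aut M\<^esub> coset M S) (coset M U \<otimes>\<^bsub>Aut M\<^esub> coset M T)
       = uniform_dist M (coset M S) (coset M T)"
proof -
  have "{x \<in> space M. compose (space M) U S x \<noteq> compose (space M) U T x} = {x \<in> space M. S x \<noteq> T x}"
    using mp_bij_in_space[OF S] mp_bij_in_space[OF T] mp_bij_eqD[OF U] by (auto simp: compose_eq)
  then show ?thesis by (simp add: Aut_mult S T U uniform_dist_coset mp_bij_compose)
qed

lemma Metric_space_Aut: "Metric_space (carrier (Aut M)) (uniform_dist M)"
proof
  show "0 \<le> uniform_dist M a b" for a b by (simp add: uniform_dist_def)
  show "uniform_dist M a b = uniform_dist M b a" for a b
    by (simp add: uniform_dist_def eq_commute)
qed (auto simp: carrier_Aut uniform_dist_eq_0 uniform_dist_triangle)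

lemma carrier_full_group:
  "carrier (full_group M R) = coset M ` {T \<in> mp_bij M. AE x in M. (T x, x) \<in> R}"
proof (intro equalityI subsetI)
  fix a assume "a \<in> carrier (full_group M R)"
  then obtain S T where "S \<in> mp_bij M" "a = coset M S" and T: "T \<in> a" "AE x in M. (T x, x) \<in> R"
    by (auto simp: full_group_def carrier_Aut)
  then have "T \<in> mp_bij M" "AE x in M. T x = S x" by (auto simp: coset_def)
  with coset_cong \<open>a = coset M S\<close> T(2) show "a \<in> coset M ` {T \<in> mp_bij M. AE x in M. (T x, x) \<in> R}"
    by blast
next
  fix a assume "a \<in> coset M ` {T \<in> mp_bij M. AE x in M. (T x, x) \<in> R}"
  then show "a \<in> carrier (full_group M R)"
    using coset_self by (force simp: full_group_def carrier_Aut)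
qed

lemma subgroup_full_group:
  assumes R: "equiv (space M) R"
  shows "subgroup (carrier (full_group M R)) (Aut M)"
proof (rule group.subgroupI[OF group_Aut])
  show "carrier (full_group M R) \<subseteq> carrier (Aut M)" by (auto simp: full_group_def)
  have "AE x in M. ((\<lambda>x\<in>space M. x) x, x) \<in> R"
    using AE_space by eventually_elim (use R in \<open>auto simp: equiv_def refl_on_def\<close>)
  then show "carrier (full_group M R) \<noteq> {}" unfolding carrier_full_group using mp_bij_id by blast
next
  fix a assume "a \<in> carrier (full_group M R)"
  then obtain T where T: "T \<in> mp_bij M" "AE x in M. (T x, x) \<in> R" "a = coset M T"
    unfolding carrier_full_group by auto
  have "AE x in M. (x, inv_into (space M) T x) \<in> R"
    using AE_mp_bij_inv[OF T(1), of "\<lambda>a b. (a, b) \<in> R"] T(2) .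
  then have "AE x in M. ((\<lambda>x\<in>space M. inv_into (space M) T x) x, x) \<in> R"
    using AE_space by eventually_elim (use R in \<open>auto simp: equiv_def sym_def\<close>)
  then show "inv\<^bsub>Aut M\<^esub> a \<in> carrier (full_group M R)"
    unfolding T(3) Aut_inv[OF T(1)] carrier_full_group using mp_bij_inv[OF T(1)] by blast
next
  fix a b assume "a \<in> carrier (full_group M R)" "b \<in> carrier (full_group M R)"
  then obtain S T where S: "S \<in> mp_bij M" "AE x in M. (S x, x) \<in> R" "a = coset M S"
    and T: "T \<in> mp_bij M" "AE x in M. (T x, x) \<in> R" "b = coset M T"
    unfolding carrier_full_group by blast
  have "AE x in M. (S (T x), T x) \<in> R" by (rule AE_mp_bij[OF T(1) S(2)])
  then have "AE x in M. (compose (space M) S T x, x) \<in> R"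
    using T(2) AE_space
    by eventually_elim (use R in \<open>auto simp: equiv_def compose_eq elim: transE\<close>)
  then show "a \<otimes>\<^bsub>Aut M\<^esub> b \<in> carrier (full_group M R)"
    unfolding S(3) T(3) Aut_mult[OF S(1) T(1)] carrier_full_group
    using mp_bij_compose[OF S(1) T(1)] by blast
qed

lemma full_group_mult [simp]: "a \<otimes>\<^bsub>full_group M R\<^esub> b = a \<otimes>\<^bsub>Aut M\<^esub> b"
  by (simp add: full_group_def)

lemma group_full_group: "equiv (space M) R \<Longrightarrow> group (full_group M R)"
  using subgroup.subgroup_is_group[OF subgroup_full_group group_Aut, of R]
  by (simp add: full_group_def)

lemma Metric_space_full_group: "Metric_space (carrier (full_group M R)) (uniform_dist M)"
  by (rule Metric_space.subspace[OF Metric_space_Aut]) (auto simp: full_group_def)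

lemma full_group_dist_right:
  assumes "a \<in> carrier (full_group M R)" "b \<in> carrier (full_group M R)" "c \<in> carrier (full_group M R)"
  shows "uniform_dist M (a \<otimes>\<^bsub>full_group M R\<^esub> c) (b \<otimes>\<^bsub>full_group M R\<^esub> c) = uniform_dist M a b"
  using assms uniform_dist_right unfolding carrier_full_group full_group_mult by blast

lemma full_group_dist_left:
  assumes "a \<in> carrier (full_group M R)" "b \<in> carrier (full_group M R)" "c \<in> carrier (full_group M R)"
  shows "uniform_dist M (c \<otimes>\<^bsub>full_group M R\<^esub> a) (c \<otimes>\<^bsub>full_group M R\<^esub> b) = uniform_dist M a b"
  using assms uniform_dist_left unfolding carrier_full_group full_group_mult by blast

lemma topological_group_full_group:
  "equiv (space M) R \<Longrightarrow> topological_group (full_group M R) (full_group_topology M R)"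
  unfolding full_group_topology_def
  by (intro topological_group_mtopology group_full_group Metric_space_full_group
      full_group_dist_right full_group_dist_left)

end

section \<open>Small sets in atomless spaces\<close>

context prob_space
begin

text \<open>Repeated halving: when \<open>B\<close> splits into \<open>C\<close> and
  \<open>B - C\<close>, both of positive measure, one of the two has at most half the measure of
  \<open>B\<close>.\<close>

lemma atomless_small_subset:
  assumes "atomless M" "A \<in> sets M" "0 < prob A" "0 < \<delta>"
  shows "\<exists>B\<in>sets M. B \<subseteq> A \<and> 0 < prob B \<and> prob B \<le> \<delta>"
proof -
  have halve: "\<exists>B\<in>sets M. B \<subseteq> A \<and> 0 < prob B \<and> prob B \<le> (1/2) ^ n" for n
  proof (induction n)
    case 0
    show ?case using assms by (intro bexI[of _ A]) auto
  next
    case (Suc n)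
    then obtain B where B: "B \<in> sets M" "B \<subseteq> A" "0 < prob B" "prob B \<le> (1/2) ^ n" by blast
    then obtain C where C: "C \<in> sets M" "C \<subseteq> B" "0 < emeasure M C" "emeasure M C < emeasure M B"
      using assms(1) unfolding atomless_def by (metis emeasure_eq_measure ennreal_less_zero_iff)
    then have C_prob: "0 < prob C" "prob C < prob B"
      by (simp_all add: emeasure_eq_measure ennreal_less_iff)
    have "prob (B - C) = prob B - prob C" by (rule finite_measure_Diff) (use B C in auto)
    then consider "prob C \<le> prob B / 2" | "prob (B - C) \<le> prob B / 2" "0 < prob (B - C)"
      using C_prob by linarith
    then show ?case
    proof cases
      case 1
      then show ?thesis using B C C_prob by (intro bexI[of _ C]) auto
    next
      case 2
      then show ?thesis using B C by (intro bexI[of _ "B - C"]) auto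
    qed
  qed
  obtain n where "(1/2) ^ n < \<delta>" using real_arch_pow_inv[of \<delta> "1/2"] assms(4) by auto
  moreover obtain B where "B \<in> sets M" "B \<subseteq> A" "0 < prob B" "prob B \<le> (1/2) ^ n" using halve by blast
  ultimately show ?thesis by (meson less_imp_le order_trans)
qed

text \<open>An exhaustion argument: \<open>s\<close> is the supremum of the measures covered by
  finitely many small sets. Families approaching \<open>s\<close> must cover almost everything,
  since a small piece of an uncovered set of positive measure could be added to exceed
  \<open>s\<close>.\<close>

lemma atomless_small_cover:
  assumes "atomless M" "0 < \<delta>"
  shows "\<exists>n P. (\<forall>i<n. P i \<in> sets M \<and> prob (P i) \<le> \<delta>) \<and> (\<Union>i<(n::nat). P i) = space M"
proof -
  define small where "small = {B \<in> sets M. prob B \<le> \<delta>}"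
  define \<F> where "\<F> = {\<C>. finite \<C> \<and> \<C> \<subseteq> small}"
  have F_sets: "\<Union>\<C> \<in> sets M" if "\<C> \<in> \<F>" for \<C>
    using that by (auto simp: \<F>_def small_def intro!: sets.finite_Union)
  define s where "s = (SUP \<C>\<in>\<F>. prob (\<Union>\<C>))"
  have "{} \<in> \<F>" by (simp add: \<F>_def)
  have bdd: "bdd_above ((\<lambda>\<C>. prob (\<Union>\<C>)) ` \<F>)" by (auto intro!: bdd_aboveI[of _ 1])
  have "\<exists>\<C>\<in>\<F>. s - 1 / Suc n < prob (\<Union>\<C>)" for n
  proof -
    have "s - 1 / Suc n < (SUP \<C>\<in>\<F>. prob (\<Union>\<C>))" by (simp add: s_def)
    then show ?thesis using less_cSUP_iff[OF _ bdd] \<open>{} \<in> \<F>\<close> by blast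
  qed
  then obtain \<C> where C: "\<And>n. \<C> n \<in> \<F>" "\<And>n. s - 1 / Suc n < prob (\<Union>(\<C> n))" by metis
  define D where "D n = (\<Union>k\<le>n. \<Union>(\<C> k))" for n
  have D_sets: "D n \<in> sets M" for n unfolding D_def using F_sets C(1) by auto
  have "prob (space M - (\<Union>n. D n)) = 0"
  proof (rule ccontr)
    assume "prob (space M - (\<Union>n. D n)) \<noteq> 0"
    then have "0 < prob (space M - (\<Union>n. D n))" by (simp add: zero_less_measure_iff)
    moreover have "space M - (\<Union>n. D n) \<in> sets M" using D_sets by auto
    ultimately obtain B where B: "B \<in> sets M" "B \<subseteq> space M - (\<Union>n. D n)" "0 < prob B" "prob B \<le> \<delta>"
      using atomless_small_subset[OF assms(1) _ _ assms(2)] by blast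
    \<comment> \<open>For this \<open>n\<close> the gain from \<open>B\<close> exceeds what the
      family \<open>\<C> n\<close> lacks to reach \<open>s\<close>.\<close>
    obtain n where n: "1 / Suc n < prob B" using nat_approx_posE[OF B(3)] by blast
    have "\<Union>(\<C> n) \<inter> B = {}" using B(2) by (auto simp: D_def)
    then have "prob (\<Union>(insert B (\<C> n))) = prob (\<Union>(\<C> n)) + prob B"
      using finite_measure_Union[OF F_sets[OF C(1)[of n]] B(1)] by (simp add: Un_commute)
    moreover have "insert B (\<C> n) \<in> \<F>" using C(1)[of n] B by (auto simp: \<F>_def small_def)
    then have "prob (\<Union>(insert B (\<C> n))) \<le> s" unfolding s_def by (rule cSUP_upper[OF _ bdd])
    ultimately show False using C(2)[of n] n by linarith
  qed
  then have "prob (\<Union>n. D n) = 1" using prob_compl[of "\<Union>n. D n"] D_sets by auto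
  moreover have "(\<lambda>n. prob (D n)) \<longlonglongrightarrow> prob (\<Union>n. D n)"
  proof (rule finite_Lim_measure_incseq)
    show "range D \<subseteq> sets M" using D_sets by blast
    show "incseq D" unfolding incseq_def D_def by (intro allI impI UN_mono) auto
  qed
  ultimately have "eventually (\<lambda>n. 1 - \<delta> < prob (D n)) sequentially"
    using assms(2) order_tendstoD(1)[of "\<lambda>n. prob (D n)" 1 sequentially "1 - \<delta>"] by simp
  then obtain n where n: "1 - \<delta> < prob (D n)" using eventually_happens'[OF sequentially_bot] by blast
  have "finite (\<Union>k\<le>n. \<C> k)" "(\<Union>k\<le>n. \<C> k) \<subseteq> small" using C(1) by (auto simp: \<F>_def)
  \<comment> \<open>After finitely many pieces the leftover is itself small and completes the
    cover.\<close>
  moreover have "space M - D n \<in> small" using n prob_compl[OF D_sets] D_sets by (auto simp: small_def)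
  ultimately have "finite (insert (space M - D n) (\<Union>k\<le>n. \<C> k))" and sub: "insert (space M - D n) (\<Union>k\<le>n. \<C> k) \<subseteq> small"
    by auto
  then obtain f and m :: nat where f: "insert (space M - D n) (\<Union>k\<le>n. \<C> k) = f ` {..<m}"
    unfolding finite_conv_nat_seg_image by (auto simp: lessThan_def)
  have "(\<Union>i<m. f i) = \<Union>(insert (space M - D n) (\<Union>k\<le>n. \<C> k))" unfolding f ..
  also have "\<dots> = space M" using sets.sets_into_space[OF D_sets[of n]] by (auto simp: D_def)
  finally show ?thesis using sub unfolding f by (intro exI[of _ m] exI[of _ f]) (auto simp: small_def)
qed

text \<open>The sets \<open>D n\<close> need not decrease, so they are dominated by their tail
  unions \<open>E n\<close>, which do; the intersection of these is the limit superior, a null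
  set.\<close>

lemma prob_tendsto_0:
  assumes "\<And>n. D n \<in> sets M" "AE x in M. eventually (\<lambda>n. x \<notin> D n) sequentially"
  shows "(\<lambda>n. prob (D n)) \<longlonglongrightarrow> 0"
proof -
  define E where "E n = (\<Union>m\<in>{n..}. D m)" for n
  have E: "E n \<in> sets M" for n unfolding E_def using assms(1) by auto
  have "AE x in M. x \<notin> (\<Inter>n. E n)"
    using assms(2) by eventually_elim (auto simp: E_def eventually_sequentially)
  then have "prob (\<Inter>n. E n) = 0" by (subst prob_eq_0) (use E in auto)
  moreover have "decseq E" unfolding decseq_def E_def by (intro allI impI UN_mono) auto
  then have "(\<lambda>n. prob (E n)) \<longlonglongrightarrow> prob (\<Inter>n. E n)"
    by (rule finite_Lim_measure_decseq[rotated]) (use E in auto)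
  ultimately have "(\<lambda>n. prob (E n)) \<longlonglongrightarrow> 0" by simp
  then show ?thesis
  proof (rule tendsto_sandwich[OF _ _ tendsto_const, rotated 2])
    show "eventually (\<lambda>n. prob (D n) \<le> prob (E n)) sequentially"
      by (rule always_eventually) (auto simp: E_def intro!: finite_measure_mono E[unfolded E_def])
  qed simp
qed

end

section \<open>Finiteness of the group generated by permutations of bounded classes\<close>

text \<open>Positive words suffice to produce a group: a finite set of bijections closed under
  composition contains the inverses of its elements.\<close>

definition word_map :: "'a set \<Rightarrow> ('a \<Rightarrow> 'a) list \<Rightarrow> 'a \<Rightarrow> 'a" where
  "word_map X gs = foldr (compose X) gs (\<lambda>x\<in>X. x)"

lemma word_map_simps:
  "word_map X [] = (\<lambda>x\<in>X. x)" "word_map X (g # gs) = compose X g (word_map X gs)"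
  by (simp_all add: word_map_def)

text \<open>The action of \<open>H\<close> on the class of a point, transported to an initial segment of the naturals,
  takes finitely many values, and together with the label of the point it determines how all words
  act on it.\<close>

lemma finite_word_maps:
  assumes H: "finite H"
    and classes: "\<And>x. x \<in> X \<Longrightarrow> \<exists>C\<subseteq>X. finite C \<and> card C \<le> k \<and> x \<in> C \<and> (\<forall>g\<in>H. g ` C \<subseteq> C)"
  shows "finite (word_map X ` lists H)"
proof -
  have "\<exists>C e. C \<subseteq> X \<and> x \<in> C \<and> (\<forall>g\<in>H. g ` C \<subseteq> C) \<and> inj_on e C \<and> e ` C \<subseteq> {..<k}" if x: "x \<in> X" for x
  proof -
    obtain C where C: "C \<subseteq> X" "finite C" "card C \<le> k" "x \<in> C" "\<forall>g\<in>H. g ` C \<subseteq> C" using classes[OF x] by blast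
    then obtain e where "e ` C \<subseteq> {..<k}" "inj_on e C"
      using card_le_inj[of C "{..<k}"] by auto
    with C show ?thesis by blast
  qed
  then obtain C e where C: "\<And>x. x \<in> X \<Longrightarrow> C x \<subseteq> X" "\<And>x. x \<in> X \<Longrightarrow> x \<in> C x"
    "\<And>x g. x \<in> X \<Longrightarrow> g \<in> H \<Longrightarrow> g ` C x \<subseteq> C x"
    and e: "\<And>x. x \<in> X \<Longrightarrow> inj_on (e x) (C x)" "\<And>x. x \<in> X \<Longrightarrow> e x ` C x \<subseteq> {..<k}"
    by metis
  define \<Theta> where "\<Theta> = (PiE (H \<times> {..<k}) (\<lambda>_. {..<k})) \<times> {..<k}"
  have "finite \<Theta>" unfolding \<Theta>_def using H by (intro finite_cartesian_product finite_PiE) auto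
  \<comment> \<open>The transition table of the generators on the labelled class of
    \<open>x\<close>. Labels not in use are sent to themselves, so that the table stays within
    \<open>{..<k}\<close>.\<close>
  define tr where "tr x = (\<lambda>(g, a)\<in>H \<times> {..<k}. if a \<in> e x ` C x then e x (g (inv_into (C x) (e x) a)) else a)" for x
  define run where "run = (\<lambda>(gs :: ('a \<Rightarrow> 'a) list) (\<tau>, a). foldr (\<lambda>g b. \<tau> (g, b)) gs (a::nat))"
  have in_C: "g y \<in> C x" if "x \<in> X" "g \<in> H" "y \<in> C x" for x g y using C(3) that by blast
  have tr_in: "(tr x, e x x) \<in> \<Theta>" if x: "x \<in> X" for x
  proof -
    have "tr x \<in> PiE (H \<times> {..<k}) (\<lambda>_. {..<k})"
      using e(2)[OF x] in_C[OF x] inv_into_into[of _ "e x" "C x"]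
      by (auto simp: tr_def PiE_iff split: if_splits) blast
    then show ?thesis using e(2)[OF x] C(2)[OF x] by (auto simp: \<Theta>_def)
  qed
  have tr_eq: "tr x (g, e x y) = e x (g y)" if "x \<in> X" "g \<in> H" "y \<in> C x" for x g y
  proof -
    have "inv_into (C x) (e x) (e x y) = y" using e(1) that by simp
    moreover have "e x y < k" using e(2)[OF that(1)] that(3) by blast
    ultimately show ?thesis using that by (simp add: tr_def)
  qed
  have run_eq: "word_map X gs x \<in> C x \<and> run gs (tr x, e x x) = e x (word_map X gs x)"
    if "x \<in> X" "gs \<in> lists H" for x gs
    using that(2)
  proof (induction gs)
    case Nil
    then show ?case using that(1) C(2) by (simp add: word_map_simps run_def)
  next
    case (Cons g gs)
    then have "word_map X (g # gs) x = g (word_map X gs x)"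
      using that(1) by (simp add: word_map_simps compose_eq)
    with Cons tr_eq[OF that(1)] in_C[OF that(1)] show ?case by (simp add: run_def)
  qed
  \<comment> \<open>The results of a word on all tables and all starting labels, whether or not they
    come from a point. This function has finite domain and range, and by \<open>det\<close> it
    determines the word map.\<close>
  define r where "r gs = (\<lambda>\<theta>\<in>\<Theta>. run gs \<theta>)" for gs
  have run_less: "run gs \<theta> < k" if gs: "gs \<in> lists H" and \<theta>_in: "\<theta> \<in> \<Theta>" for gs \<theta>
  proof -
    obtain \<tau> a where \<theta>: "\<theta> = (\<tau>, a)" "\<tau> \<in> PiE (H \<times> {..<k}) (\<lambda>_. {..<k})" "a < k"
      using \<theta>_in by (auto simp: \<Theta>_def)
    show ?thesis using gs
    proof (induction gs)
      case Nil
      then show ?case using \<theta> by (simp add: run_def)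
    next
      case (Cons g gs)
      then show ?case using PiE_mem[OF \<theta>(2), of "(g, run gs \<theta>)"] \<theta>(1) by (simp add: run_def)
    qed
  qed
  then have "r gs \<in> PiE \<Theta> (\<lambda>_. {..<k})" if "gs \<in> lists H" for gs
    unfolding r_def restrict_PiE_iff using that by blast
  then have "r ` lists H \<subseteq> PiE \<Theta> (\<lambda>_. {..<k})" by blast
  then have fin: "finite (r ` lists H)"
    by (rule finite_subset) (use \<open>finite \<Theta>\<close> in \<open>auto intro: finite_PiE\<close>)
  have ext: "word_map X us \<in> extensional X" for us
    by (cases us) (auto simp: word_map_simps)
  have det: "word_map X gs = word_map X hs" if "gs \<in> lists H" "hs \<in> lists H" "r gs = r hs" for gs hs
  proof (rule extensionalityI[OF ext ext])
    fix x assume x: "x \<in> X"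
    have "e x (word_map X gs x) = e x (word_map X hs x)"
      using run_eq[OF x that(1)] run_eq[OF x that(2)] fun_cong[OF that(3), of "(tr x, e x x)"] tr_in[OF x]
      by (simp add: r_def)
    then show "word_map X gs x = word_map X hs x"
      using e(1)[OF x] run_eq[OF x that(1)] run_eq[OF x that(2)] by (simp add: inj_on_eq_iff)
  qed
  have "word_map X ` lists H \<subseteq> (\<lambda>v. word_map X (SOME gs. gs \<in> lists H \<and> r gs = v)) ` r ` lists H"
  proof
    fix T assume "T \<in> word_map X ` lists H"
    then obtain gs where gs: "gs \<in> lists H" "T = word_map X gs" by blast
    have "(SOME hs. hs \<in> lists H \<and> r hs = r gs) \<in> lists H \<and> r (SOME hs. hs \<in> lists H \<and> r hs = r gs) = r gs"
      by (rule someI[of _ gs]) (use gs in simp)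
    then have "T = word_map X (SOME hs. hs \<in> lists H \<and> r hs = r gs)"
      using det[OF gs(1), of "SOME hs. hs \<in> lists H \<and> r hs = r gs"] gs(2) by simp
    with gs(1) show "T \<in> (\<lambda>v. word_map X (SOME gs. gs \<in> lists H \<and> r gs = v)) ` r ` lists H" by blast
  qed
  then show ?thesis by (rule finite_subset) (use fin in simp)
qed

section \<open>Closing up the chains of a partial isomorphism\<close>

text \<open>A partial injection \<open>T | B\<close> preserving finite classes is a union of cycles and finite chains.
  Sending the endpoint \<open>x \<notin> B\<close> of a chain back to its origin turns it into a permutation: the origin
  is the first point \<open>T\<^sup>-\<^sup>k x\<close> outside \<open>T ` B\<close>.\<close>

definition closed_up :: "'a set \<Rightarrow> ('a \<Rightarrow> 'a) \<Rightarrow> 'a set \<Rightarrow> 'a \<Rightarrow> 'a" where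
  "closed_up X T B = (\<lambda>x\<in>X. if x \<in> B then T x
     else (inv_into X T ^^ (LEAST k. (inv_into X T ^^ k) x \<notin> T ` B)) x)"

text \<open>The classes partition all of \<open>X\<close>, but finiteness and invariance under
  \<open>T\<close> are asked only at points of \<open>B\<close>. By \<open>cls_eq\<close>, every
  class meeting \<open>B\<close> is finite.\<close>

locale partial_isomorphism =
  fixes X :: "'a set" and T :: "'a \<Rightarrow> 'a" and B :: "'a set" and C :: "'a \<Rightarrow> 'a set"
  assumes bij: "bij_betw T X X" and B: "B \<subseteq> X"
    and cls_sub: "\<And>x. x \<in> X \<Longrightarrow> C x \<subseteq> X" and cls_refl: "\<And>x. x \<in> X \<Longrightarrow> x \<in> C x"
    and cls_eq: "\<And>x y. x \<in> X \<Longrightarrow> y \<in> C x \<Longrightarrow> C y = C x"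
    and T_cls: "\<And>x. x \<in> B \<Longrightarrow> T x \<in> C x" and fin_cls: "\<And>x. x \<in> B \<Longrightarrow> finite (C x)"
begin

abbreviation I where "I \<equiv> inv_into X T"

definition "origin x = (LEAST k. (I ^^ k) x \<notin> T ` B)"

lemma closed_up_in: "x \<in> B \<Longrightarrow> closed_up X T B x = T x"
  using B by (auto simp: closed_up_def)

lemma closed_up_notin: "x \<in> X \<Longrightarrow> x \<notin> B \<Longrightarrow> closed_up X T B x = (I ^^ origin x) x"
  by (simp add: closed_up_def origin_def)

lemma closed_up_extensional: "closed_up X T B \<in> extensional X"
  unfolding closed_up_def by (rule restrict_extensional)

lemma I_bij: "bij_betw I X X"
  using bij by (rule bij_betw_inv_into)

lemma I_pow_in: "x \<in> X \<Longrightarrow> (I ^^ k) x \<in> X"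
  using bij_betw_funpow[OF I_bij] bij_betwE by blast

lemma T_I: "x \<in> X \<Longrightarrow> T (I x) = x"
  using bij by (rule bij_betw_inv_into_right)

lemma I_T: "x \<in> X \<Longrightarrow> I (T x) = x"
  using bij by (rule bij_betw_inv_into_left)

lemma I_in_B: "y \<in> T ` B \<Longrightarrow> I y \<in> B"
  using B I_T by auto

lemma I_cls: "y \<in> T ` B \<Longrightarrow> C (I y) = C y \<and> I y \<in> C y \<and> finite (C y)"
proof -
  assume y: "y \<in> T ` B"
  then have I: "I y \<in> B" by (rule I_in_B)
  have "y \<in> X" using y B bij_betwE[OF bij] by blast
  then have "y \<in> C (I y)" using T_cls[OF I] T_I by simp
  then have "C y = C (I y)" using cls_eq I B by blast
  then show ?thesis using cls_refl[of "I y"] fin_cls[OF I] I B by auto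
qed

lemma chain_cls:
  assumes "x \<in> X" "\<And>j. j < n \<Longrightarrow> (I ^^ j) x \<in> T ` B"
  shows "C ((I ^^ n) x) = C x \<and> (I ^^ n) x \<in> C x"
  using assms
proof (induction n)
  case 0
  then show ?case by (simp add: cls_refl)
next
  case (Suc n)
  then have "C ((I ^^ n) x) = C x" by simp
  with I_cls[OF Suc.prems(2)[of n]] show ?case by simp
qed

lemma chain_stops:
  assumes x: "x \<in> X" "x \<notin> B"
  shows "\<exists>k. (I ^^ k) x \<notin> T ` B"
proof (rule ccontr)
  assume "\<nexists>k. (I ^^ k) x \<notin> T ` B"
  then have all: "(I ^^ k) x \<in> T ` B" for k by blast
  have fin: "finite (C x)" using I_cls[OF all[of 0]] by simp
  define f where "f k = (I ^^ k) x" for k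
  have "range f \<subseteq> C x" using chain_cls[OF x(1) all] by (auto simp: f_def)
  then have "finite (range f)" using fin by (rule finite_subset)
  then have "\<not> inj f" using finite_imageD[of f UNIV] by auto
  then obtain i j where "i < j" "f i = f j"
    using linorder_injI[of f] by blast
  then have ij: "(I ^^ i) x = (I ^^ j) x" by (simp add: f_def)
  obtain l where "j = i + Suc l" using less_imp_Suc_add[OF \<open>i < j\<close>] by auto
  then have "(I ^^ i) x = (I ^^ i) ((I ^^ Suc l) x)"
    using ij by (simp only: funpow_add comp_apply)
  moreover have "inj_on (I ^^ i) X" using bij_betw_funpow[OF I_bij] by (simp add: bij_betw_def)
  ultimately have "x = (I ^^ Suc l) x"
    using inj_onD[of "I ^^ i" X x "(I ^^ Suc l) x"] x(1) I_pow_in[OF x(1), of "Suc l"] by blast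
  also have "\<dots> = I ((I ^^ l) x)" by simp
  finally have "x \<in> B" using I_in_B[OF all[of l]] by simp
  with x(2) show False by blast
qed

lemma origin_notin: "x \<in> X \<Longrightarrow> x \<notin> B \<Longrightarrow> (I ^^ origin x) x \<notin> T ` B"
  unfolding origin_def using chain_stops by (rule LeastI_ex)

lemma before_origin: "j < origin x \<Longrightarrow> (I ^^ j) x \<in> T ` B"
  unfolding origin_def using not_less_Least by blast

lemma closed_up_cls:
  assumes "x \<in> X"
  shows "closed_up X T B x \<in> C x"
  using assms T_cls chain_cls[OF assms before_origin] closed_up_in closed_up_notin by metis

lemma T_pow_I_pow: "x \<in> X \<Longrightarrow> (T ^^ k) ((I ^^ k) x) = x"
proof (induction k)
  case (Suc k)
  have "(T ^^ Suc k) ((I ^^ Suc k) x) = (T ^^ k) (T (I ((I ^^ k) x)))"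
    by (simp add: funpow_swap1)
  then show ?case using Suc T_I[OF I_pow_in] by simp
qed simp

text \<open>Two endpoints of chains with the same origin coincide: otherwise one of them would be an
  inner point of the chain of the other.\<close>

lemma same_origin_le:
  assumes x: "x \<in> X" "x \<notin> B" and y: "y \<in> X" "y \<notin> B"
    and eq: "(I ^^ origin x) x = (I ^^ origin y) y" and le: "origin x \<le> origin y"
  shows "x = y"
proof -
  define m where "m = origin y - origin x"
  have "(I ^^ origin y) y = (I ^^ origin x) ((I ^^ m) y)"
    using le by (metis m_def comp_apply funpow_add le_add_diff_inverse)
  then have "x = (I ^^ m) y"
    using eq T_pow_I_pow[OF x(1), of "origin x"] T_pow_I_pow[OF I_pow_in[OF y(1)], of "origin x" m] by metis
  show ?thesis
  proof (cases m)
    case 0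
    then show ?thesis using \<open>x = (I ^^ m) y\<close> by simp
  next
    case (Suc l)
    then have "l < origin y" by (simp add: m_def)
    then have "I ((I ^^ l) y) \<in> B" by (intro I_in_B before_origin)
    then have "x \<in> B" using \<open>x = (I ^^ m) y\<close> Suc by simp
    with x(2) show ?thesis by blast
  qed
qed

lemma closed_up_inj: "inj_on (closed_up X T B) X"
proof (rule inj_onI)
  fix x y assume x: "x \<in> X" and y: "y \<in> X" and eq: "closed_up X T B x = closed_up X T B y"
  consider "x \<in> B" "y \<in> B" | "x \<in> B" "y \<notin> B" | "x \<notin> B" "y \<in> B" | "x \<notin> B" "y \<notin> B" by blast
  then show "x = y"
  proof cases
    case 1
    then show ?thesis using eq closed_up_in I_T x y by metis
  next
    case 2
    then show ?thesis using eq closed_up_in closed_up_notin[OF y] origin_notin[OF y] by (metis imageI)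
  next
    case 3
    then show ?thesis using eq closed_up_in closed_up_notin[OF x] origin_notin[OF x] by (metis imageI)
  next
    case 4
    then have "(I ^^ origin x) x = (I ^^ origin y) y" using eq closed_up_notin x y by simp
    then show ?thesis using same_origin_le[of x y] same_origin_le[of y x] x y 4 by (metis nle_le)
  qed
qed

text \<open>In a class that misses \<open>B\<close> all chains have length zero. This makes the
  generators trivial on classes that are infinite or too large, where no bound on their action would
  be available.\<close>

lemma closed_up_id:
  assumes "x \<in> X" "C x \<inter> B = {}"
  shows "closed_up X T B x = x"
proof -
  have "x \<notin> B" using assms cls_refl by blast
  moreover have "x \<notin> T ` B" using assms(2) I_cls I_in_B by blast
  then have "origin x = 0" unfolding origin_def by (intro Least_equality) auto
  ultimately show ?thesis using closed_up_notin[OF assms(1)] by simp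
qed

text \<open>Surjectivity is checked class by class: a class meeting \<open>B\<close> is finite and
  mapped injectively into itself, and any other class is fixed pointwise.\<close>

lemma closed_up_bij: "bij_betw (closed_up X T B) X X"
  unfolding bij_betw_def
proof (intro conjI equalityI subsetI)
  show "inj_on (closed_up X T B) X" by (rule closed_up_inj)
  show "y \<in> X" if "y \<in> closed_up X T B ` X" for y using that closed_up_cls cls_sub by blast
  fix y assume y: "y \<in> X"
  show "y \<in> closed_up X T B ` X"
  proof (cases "C y \<inter> B = {}")
    case True
    then show ?thesis using closed_up_id[OF y] y by (metis imageI)
  next
    case False
    then obtain b where "b \<in> C y" "b \<in> B" by blast
    then have fin: "finite (C y)" using fin_cls cls_eq[OF y] by metis
    have "closed_up X T B ` C y \<subseteq> C y" using closed_up_cls cls_eq[OF y] cls_sub[OF y] by blast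
    moreover have "inj_on (closed_up X T B) (C y)" using closed_up_inj cls_sub[OF y] by (rule inj_on_subset)
    ultimately have "closed_up X T B ` C y = C y" by (rule endo_inj_surj[OF fin])
    then have "y \<in> closed_up X T B ` C y" using cls_refl[OF y] by simp
    then show ?thesis using cls_sub[OF y] by blast
  qed
qed

end

lemma mp_bij_pow:
  assumes "T \<in> mp_bij M"
  shows "(\<lambda>x\<in>space M. (T ^^ k) x) \<in> mp_bij M"
proof (induction k)
  case 0
  show ?case unfolding funpow_0 by (rule mp_bij_id)
next
  case (Suc k)
  have "compose (space M) T (\<lambda>x\<in>space M. (T ^^ k) x) = (\<lambda>x\<in>space M. (T ^^ Suc k) x)"
    by (auto simp: compose_def fun_eq_iff)
  with mp_bij_compose[OF assms Suc] show ?case by (simp only:)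
qed

lemma closed_up_mp_bij:
  assumes T: "T \<in> mp_bij M" and B_sets: "B \<in> sets M" and "partial_isomorphism (space M) T B C"
  shows "closed_up (space M) T B \<in> mp_bij M"
proof -
  interpret partial_isomorphism "space M" T B C by fact
  define J where "J = (\<lambda>x\<in>space M. inv_into (space M) T x)"
  have J: "J \<in> mp_bij M" unfolding J_def by (rule mp_bij_inv[OF T])
  have JI: "(J ^^ k) x = (I ^^ k) x" if "x \<in> space M" for k x
    by (induction k) (use that I_pow_in in \<open>simp_all add: J_def\<close>)
  define Jk where "Jk k = (\<lambda>x\<in>space M. (J ^^ k) x)" for k
  have Jk: "Jk k \<in> mp_bij M" for k unfolding Jk_def by (rule mp_bij_pow[OF J])
  \<comment> \<open>The value 0 marks \<open>B\<close>, where the map is \<open>T\<close>; the value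
    \<open>Suc k\<close> marks endpoints whose origin lies \<open>k\<close> steps back.\<close>
  define idx where "idx x = (if x \<in> B then 0 else Suc (LEAST k. Jk k x \<notin> T ` B))" for x
  define F where "F i = (case i of 0 \<Rightarrow> T | Suc k \<Rightarrow> Jk k)" for i
  show ?thesis
  proof (rule mp_bij_piecewise[where idx = idx and F = F])
    show "closed_up (space M) T B \<in> Bij (space M)"
      unfolding Bij_def using closed_up_bij closed_up_extensional by blast
    show "F i \<in> mp_bij M" for i using T Jk by (cases i) (simp_all add: F_def)
    show "closed_up (space M) T B x = F (idx x) x" if x: "x \<in> space M" for x
    proof (cases "x \<in> B")
      case True
      then show ?thesis by (simp add: F_def idx_def closed_up_in)
    next
      case False
      have "Jk k x = (I ^^ k) x" for k using x JI by (simp add: Jk_def)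
      with False x show ?thesis by (simp add: F_def idx_def closed_up_notin origin_def)
    qed
    have [measurable]: "T ` B \<in> sets M" "B \<in> sets M" using mp_bij_image_sets[OF T B_sets] B_sets by auto
    have [measurable]: "Jk k \<in> M \<rightarrow>\<^sub>M M" for k by (rule mp_bij_measurable[OF Jk])
    show "idx \<in> M \<rightarrow>\<^sub>M count_space UNIV" unfolding idx_def by measurable
  qed
qed

section \<open>Blocks invariant under a finite group\<close>

definition block_map :: "'a set \<Rightarrow> ('a \<Rightarrow> nat) \<Rightarrow> ('a \<Rightarrow> 'a) list \<Rightarrow> 'a \<Rightarrow> 'a" where
  "block_map X idx xs = (\<lambda>x\<in>X. (xs ! idx x) x)"

text \<open>The equivariance demanded of a Levy approximation: translating all entries by
  \<open>t\<close> is left multiplication by \<open>t\<close>.\<close>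

lemma block_map_map:
  assumes "\<And>x. x \<in> X \<Longrightarrow> idx x < length xs"
  shows "block_map X idx (map (compose X t) xs) = compose X t (block_map X idx xs)"
  using assms by (auto simp: block_map_def compose_def fun_eq_iff)

lemma bij_betw_compose_left:
  assumes "finite S" "S \<subseteq> mp_bij M" "t \<in> S" "\<And>s. s \<in> S \<Longrightarrow> compose (space M) t s \<in> S"
  shows "bij_betw (compose (space M) t) S S"
proof -
  have "inj_on (compose (space M) t) S"
  proof (rule inj_onI)
    fix a b assume ab: "a \<in> S" "b \<in> S" "compose (space M) t a = compose (space M) t b"
    have mp: "a \<in> mp_bij M" "b \<in> mp_bij M" "t \<in> mp_bij M" using ab assms by auto
    show "a = b"
    proof (rule extensionalityI[OF mp_bij_ext[OF mp(1)] mp_bij_ext[OF mp(2)]])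
      fix x assume x: "x \<in> space M"
      then have "t (a x) = t (b x)" using fun_cong[OF ab(3), of x] by (simp add: compose_eq)
      then show "a x = b x"
        by (rule mp_bij_eqD[OF mp(3) mp_bij_in_space[OF mp(1) x] mp_bij_in_space[OF mp(2) x]])
    qed
  qed
  moreover have "compose (space M) t ` S \<subseteq> S" using assms(4) by blast
  ultimately show ?thesis using endo_inj_surj[OF assms(1)] by (simp add: bij_betw_def)
qed

lemma bij_betw_compose_right:
  assumes "finite S" "S \<subseteq> mp_bij M" "t \<in> S" "\<And>s. s \<in> S \<Longrightarrow> compose (space M) s t \<in> S"
  shows "bij_betw (\<lambda>s. compose (space M) s t) S S"
proof -
  have "inj_on (\<lambda>s. compose (space M) s t) S"
  proof (rule inj_onI)
    fix a b assume ab: "a \<in> S" "b \<in> S" "compose (space M) a t = compose (space M) b t"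
    have mp: "a \<in> mp_bij M" "b \<in> mp_bij M" "t \<in> mp_bij M" using ab assms by auto
    show "a = b"
    proof (rule extensionalityI[OF mp_bij_ext[OF mp(1)] mp_bij_ext[OF mp(2)]])
      fix x assume "x \<in> space M"
      then obtain y where y: "y \<in> space M" "x = t y" using mp_bij_bij[OF mp(3)] by (auto simp: bij_betw_def)
      then show "a x = b x" using fun_cong[OF ab(3), of y] by (simp add: compose_eq)
    qed
  qed
  moreover have "(\<lambda>s. compose (space M) s t) ` S \<subseteq> S" using assms(4) by blast
  ultimately show ?thesis using endo_inj_surj[OF assms(1)] by (simp add: bij_betw_def)
qed

text \<open>Elements of \<open>S\<close> preserve the value of \<open>idx\<close>, so each entry
  permutes its own block and the pieces glue to a bijection.\<close>

lemma block_map_mp_bij: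
  assumes idx: "idx \<in> M \<rightarrow>\<^sub>M count_space UNIV" "\<And>x. x \<in> space M \<Longrightarrow> idx x < length xs"
    and S: "S \<subseteq> mp_bij M" "set xs \<subseteq> S"
    and inv: "\<And>s x. s \<in> S \<Longrightarrow> x \<in> space M \<Longrightarrow> idx (s x) = idx x"
  shows "block_map (space M) idx xs \<in> mp_bij M"
proof (rule mp_bij_piecewise[OF _ idx(1)])
  \<comment> \<open>The identity is a default beyond the list, so that every piece is a
    measure-preserving bijection.\<close>
  let ?F = "\<lambda>i. if i < length xs then xs ! i else (\<lambda>x\<in>space M. x)"
  have S_in: "xs ! idx x \<in> S" if "x \<in> space M" for x using idx(2)[OF that] S(2) nth_mem by blast
  have mp: "xs ! idx x \<in> mp_bij M" if "x \<in> space M" for x using S_in[OF that] S(1) by blast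
  have idx_eq: "idx (block_map (space M) idx xs x) = idx x" if "x \<in> space M" for x
    using inv[OF S_in] that by (simp add: block_map_def)
  show "?F i \<in> mp_bij M" for i
  proof (cases "i < length xs")
    case True
    then have "xs ! i \<in> mp_bij M" using S nth_mem[OF True] by blast
    with True show ?thesis by simp
  qed (simp add: mp_bij_id del: restrict_apply)
  show "block_map (space M) idx xs x = ?F (idx x) x" if "x \<in> space M" for x
    using idx(2) that by (simp add: block_map_def)
  have "bij_betw (block_map (space M) idx xs) (space M) (space M)"
    unfolding bij_betw_def
  proof (intro conjI equalityI subsetI inj_onI)
    fix x y assume xy: "x \<in> space M" "y \<in> space M" "block_map (space M) idx xs x = block_map (space M) idx xs y"
    then have "idx x = idx y" using idx_eq by metis
    then have "(xs ! idx x) x = (xs ! idx x) y" using xy by (simp add: block_map_def)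
    then show "x = y" by (rule mp_bij_eqD[OF mp[OF xy(1)] xy(1,2)])
  next
    fix y assume "y \<in> block_map (space M) idx xs ` space M"
    then show "y \<in> space M" using mp_bij_in_space[OF mp] by (auto simp: block_map_def)
  next
    fix y assume y: "y \<in> space M"
    then obtain x where x: "x \<in> space M" "y = (xs ! idx y) x"
      using mp_bij_bij[OF mp[OF y]] by (auto simp: bij_betw_def)
    then have "idx x = idx y" using inv[OF S_in[OF y] x(1)] by simp
    then have "block_map (space M) idx xs x = y" using x by (simp add: block_map_def)
    then show "y \<in> block_map (space M) idx xs ` space M" using x(1) by blast
  qed
  then show "block_map (space M) idx xs \<in> Bij (space M)" by (simp add: Bij_def block_map_def)
qed

context standard_prob
begin

text \<open>The sets of a small cover are saturated under \<open>S\<close>, and each point is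
  assigned to the first saturated set containing it. Saturation multiplies the measure by at most
  \<open>card S\<close>, hence the initial bound \<open>\<delta> / card S\<close>.\<close>

lemma invariant_blocks:
  assumes "atomless M" "0 < \<delta>" and S: "finite S" "S \<subseteq> mp_bij M" "(\<lambda>x\<in>space M. x) \<in> S"
    and closed: "\<And>s t. s \<in> S \<Longrightarrow> t \<in> S \<Longrightarrow> compose (space M) s t \<in> S"
  shows "\<exists>n idx. idx \<in> M \<rightarrow>\<^sub>M count_space UNIV \<and> (\<forall>x\<in>space M. idx x < (n::nat)) \<and>
     (\<forall>s\<in>S. \<forall>x\<in>space M. idx (s x) = idx x) \<and> (\<forall>i. prob {x \<in> space M. idx x = i} \<le> \<delta>)"
proof -
  have card: "0 < real (card S)" using S by (auto simp: card_gt_0_iff)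
  then have "0 < \<delta> / card S" using assms(2) by simp
  from atomless_small_cover[OF assms(1) this] obtain n :: nat and P where
    P: "\<And>i. i < n \<Longrightarrow> P i \<in> sets M" "\<And>i. i < n \<Longrightarrow> prob (P i) \<le> \<delta> / card S" "(\<Union>i<n. P i) = space M"
    by blast
  define Q where "Q i x \<longleftrightarrow> i < n \<and> (\<exists>s\<in>S. s x \<in> P i)" for i x
  define idx where "idx x = (LEAST i. Q i x)" for x
  have ex: "\<exists>i. Q i x" if x: "x \<in> space M" for x
  proof -
    obtain i where "i < n" "x \<in> P i" using P(3) x by blast
    then have "Q i x" unfolding Q_def using S(3) x by (metis restrict_apply')
    then show ?thesis ..
  qed
  have idx: "Q (idx x) x" if "x \<in> space M" for x unfolding idx_def using ex[OF that] by (rule LeastI_ex)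
  have Q_inv: "Q i (t x) \<longleftrightarrow> Q i x" if t: "t \<in> S" and x: "x \<in> space M" for i t x
  proof -
    \<comment> \<open>Right multiplication by \<open>t\<close> permutes \<open>S\<close>, so the
      saturated set does not distinguish \<open>x\<close> from \<open>t x\<close>.\<close>
    have "(\<exists>s\<in>S. s x \<in> P i) \<longleftrightarrow> (\<exists>s\<in>(\<lambda>s. compose (space M) s t) ` S. s x \<in> P i)"
      using bij_betw_compose_right[OF S(1,2) t closed[OF _ t]] unfolding bij_betw_def by simp
    also have "\<dots> \<longleftrightarrow> (\<exists>s\<in>S. s (t x) \<in> P i)" using x by (simp add: compose_eq)
    finally show ?thesis by (simp add: Q_def)
  qed
  have Qset: "{x \<in> space M. Q i x} = (if i < n then (\<Union>s\<in>S. s -` P i \<inter> space M) else {})" for i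
    by (auto simp: Q_def)
  have sP: "s -` P i \<inter> space M \<in> sets M" if "s \<in> S" "i < n" for s i
    using measurable_sets[OF mp_bij_measurable P(1)[OF that(2)]] S(2) that(1) by blast
  have Qm: "{x \<in> space M. Q i x} \<in> sets M" for i
  proof (cases "i < n")
    case True
    then have "(\<Union>s\<in>S. s -` P i \<inter> space M) \<in> sets M" by (intro sets.finite_UN S(1) sP)
    with True show ?thesis unfolding Qset by (simp only: if_True)
  next
    case False
    then show ?thesis unfolding Qset by simp
  qed
  have "idx \<in> M \<rightarrow>\<^sub>M count_space UNIV"
    unfolding idx_def by (rule measurable_Least) (use Qm in \<open>simp add: pred_def\<close>)
  moreover have "\<forall>x\<in>space M. idx x < n" using idx by (simp add: Q_def)
  moreover have "\<forall>s\<in>S. \<forall>x\<in>space M. idx (s x) = idx x" using Q_inv by (simp add: idx_def)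
  moreover have "prob {x \<in> space M. idx x = i} \<le> \<delta>" for i
  proof -
    have "prob {x \<in> space M. idx x = i} \<le> prob {x \<in> space M. Q i x}"
      by (rule finite_measure_mono[OF _ Qm]) (use idx in blast)
    also have "\<dots> \<le> \<delta>"
    proof (cases "i < n")
      case True
      have "prob (\<Union>s\<in>S. s -` P i \<inter> space M) \<le> (\<Sum>s\<in>S. prob (s -` P i \<inter> space M))"
        by (rule finite_measure_subadditive_finite[OF S(1)]) (use sP True in blast)
      also have "\<dots> = (\<Sum>s\<in>S. prob (P i))"
        using mp_bij_vimage[OF _ P(1)[OF True]] S(2) by (intro sum.cong) (auto simp: measure_def)
      also have "\<dots> = real (card S) * prob (P i)" by simp
      also have "\<dots> \<le> real (card S) * (\<delta> / card S)" by (intro mult_left_mono P(2) True) simp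
      also have "\<dots> = \<delta>" using card by simp
      finally show ?thesis using True by (simp add: Qset)
    next
      case False
      then show ?thesis using assms(2) by (simp add: Qset)
    qed
    finally show ?thesis .
  qed
  ultimately show ?thesis by blast
qed

text \<open>Two block maps can differ only on blocks whose entries differ, and the measures of these
  blocks are the Hamming weights.\<close>

lemma uniform_dist_block_map:
  assumes idx: "idx \<in> M \<rightarrow>\<^sub>M count_space UNIV" "\<And>x. x \<in> space M \<Longrightarrow> idx x < n"
    and "length xs = n" "length ys = n"
    and mp: "block_map (space M) idx xs \<in> mp_bij M" "block_map (space M) idx ys \<in> mp_bij M"
  shows "uniform_dist M (coset M (block_map (space M) idx xs)) (coset M (block_map (space M) idx ys))
       \<le> hamming (\<lambda>i. prob {x \<in> space M. idx x = i}) xs ys"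
proof -
  have A: "{x \<in> space M. idx x = i} \<in> sets M" for i
    using measurable_sets[OF idx(1), of "{i}"] by (simp add: vimage_def Int_def conj_commute)
  let ?D = "{i. i < n \<and> xs ! i \<noteq> ys ! i}"
  have "prob {x \<in> space M. block_map (space M) idx xs x \<noteq> block_map (space M) idx ys x}
      \<le> prob (\<Union>i\<in>?D. {x \<in> space M. idx x = i})"
  proof (rule finite_measure_mono)
    show "{x \<in> space M. block_map (space M) idx xs x \<noteq> block_map (space M) idx ys x}
        \<subseteq> (\<Union>i\<in>?D. {x \<in> space M. idx x = i})"
      using idx(2) by (auto simp: block_map_def)
  qed (use A in auto)
  also have "\<dots> \<le> (\<Sum>i\<in>?D. prob {x \<in> space M. idx x = i})"
    by (rule finite_measure_subadditive_finite) (use A in auto)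
  also have "\<dots> = hamming (\<lambda>i. prob {x \<in> space M. idx x = i}) xs ys"
    unfolding hamming_def assms(3) by (subst sum.inter_filter[symmetric]) (auto intro!: sum.cong)
  finally show ?thesis by (simp add: uniform_dist_coset[OF mp])
qed

text \<open>One factor of each square is bounded by \<open>\<delta>\<close>; the remaining factors
  are measures of disjoint sets and add up to at most 1. The bound is independent of
  \<open>n\<close>.\<close>

lemma sum_square_prob_le:
  assumes idx: "idx \<in> M \<rightarrow>\<^sub>M count_space UNIV"
    and small: "\<And>i. prob {x \<in> space M. idx x = i} \<le> \<delta>"
  shows "(\<Sum>i<n::nat. (prob {x \<in> space M. idx x = i})\<^sup>2) \<le> \<delta>"
proof -
  let ?A = "\<lambda>i. {x \<in> space M. idx x = i}"
  have A: "?A i \<in> sets M" for i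
    using measurable_sets[OF idx(1), of "{i}"] by (simp add: vimage_def Int_def conj_commute)
  have "0 \<le> \<delta>" by (rule order_trans[OF measure_nonneg small])
  have "(\<Sum>i<n. (prob (?A i))\<^sup>2) \<le> (\<Sum>i<n. \<delta> * prob (?A i))"
    unfolding power2_eq_square by (intro sum_mono mult_right_mono small) auto
  also have "\<dots> = \<delta> * prob (\<Union>i\<in>{..<n}. ?A i)"
    by (subst finite_measure_finite_Union) (use A in \<open>auto simp: disjoint_family_on_def sum_distrib_left\<close>)
  also have "\<dots> \<le> \<delta> * 1" using \<open>0 \<le> \<delta>\<close> by (intro mult_left_mono prob_le_1)
  finally show ?thesis by simp
qed

end

section \<open>Approximation by finite groups\<close>

lemma word_map_mp_bij:
  "gs \<in> lists (mp_bij M) \<Longrightarrow> word_map (space M) gs \<in> mp_bij M"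
  by (induction gs) (simp_all add: word_map_simps mp_bij_id mp_bij_compose del: restrict_apply)

lemma word_map_append:
  assumes "gs \<in> lists (mp_bij M)" "hs \<in> lists (mp_bij M)"
  shows "word_map (space M) (gs @ hs) = compose (space M) (word_map (space M) gs) (word_map (space M) hs)"
proof -
  have h: "word_map (space M) hs \<in> space M \<rightarrow> space M" "word_map (space M) hs \<in> extensional (space M)"
    using mp_bij_in_space[OF word_map_mp_bij[OF assms(2)]] mp_bij_ext[OF word_map_mp_bij[OF assms(2)]]
    by auto
  show ?thesis using assms(1)
  proof (induction gs)
    case Nil
    show ?case using Id_compose[OF h] by (simp add: word_map_simps del: restrict_apply)
  next
    case (Cons g gs)
    then show ?case using compose_assoc[OF h(1)] by (simp add: word_map_simps)
  qed
qed

text \<open>\<open>S\<close> consists of all words in the closed-up maps of the members of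
  \<open>\<T>\<close>. Each such map agrees with \<open>T\<close> on \<open>B T\<close> and
  preserves every class, and the bound \<open>k\<close> makes the set of words finite.\<close>

lemma finite_group_approximation:
  assumes \<T>: "finite \<T>" "\<T> \<subseteq> mp_bij M"
    and cls_sub: "\<And>x. x \<in> space M \<Longrightarrow> C x \<subseteq> space M" and cls_refl: "\<And>x. x \<in> space M \<Longrightarrow> x \<in> C x"
    and cls_eq: "\<And>x y. x \<in> space M \<Longrightarrow> y \<in> C x \<Longrightarrow> C y = C x"
    and B: "\<And>T. B T = {x \<in> space M. T x \<in> C x \<and> finite (C x) \<and> card (C x) \<le> k}"
    and B_sets: "\<And>T. T \<in> \<T> \<Longrightarrow> B T \<in> sets M"
  shows "\<exists>S. finite S \<and> S \<subseteq> mp_bij M \<and> (\<lambda>x\<in>space M. x) \<in> S \<and>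
     (\<forall>s\<in>S. \<forall>t\<in>S. compose (space M) s t \<in> S) \<and> (\<forall>s\<in>S. \<forall>x\<in>space M. s x \<in> C x) \<and>
     (\<forall>T\<in>\<T>. \<exists>T'\<in>S. \<forall>x\<in>B T. T' x = T x)"
proof -
  let ?X = "space M"
  define H where "H = (\<lambda>T. closed_up ?X T (B T)) ` \<T>"
  have pi: "partial_isomorphism ?X T (B T) C" if "T \<in> \<T>" for T
  proof
    show "bij_betw T ?X ?X" using that \<T>(2) by (intro mp_bij_bij) blast
    show "B T \<subseteq> ?X" "\<And>x. x \<in> B T \<Longrightarrow> T x \<in> C x" "\<And>x. x \<in> B T \<Longrightarrow> finite (C x)"
      unfolding B by blast+
  qed (fact cls_sub cls_refl cls_eq)+
  have H_mp: "H \<subseteq> mp_bij M"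
  proof
    fix h assume "h \<in> H"
    then obtain T where T: "T \<in> \<T>" "h = closed_up ?X T (B T)" unfolding H_def by blast
    then have "T \<in> mp_bij M" using \<T>(2) by blast
    then show "h \<in> mp_bij M" unfolding T(2) by (rule closed_up_mp_bij[OF _ B_sets[OF T(1)] pi[OF T(1)]])
  qed
  have H_cls: "h x \<in> C x" if h: "h \<in> H" and x: "x \<in> ?X" for h x
  proof -
    obtain T where T: "T \<in> \<T>" "h = closed_up ?X T (B T)" using h unfolding H_def by blast
    show ?thesis unfolding T(2) by (rule partial_isomorphism.closed_up_cls[OF pi[OF T(1)] x])
  qed
  have "finite (word_map ?X ` lists H)"
  proof (rule finite_word_maps)
    show "finite H" using \<T>(1) by (simp add: H_def)
    fix x assume x: "x \<in> ?X"
    \<comment> \<open>Points of classes that are infinite or have more than \<open>k\<close>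
      elements are fixed and use the singleton \<open>{x}\<close>; \<open>Suc k\<close> admits it
      even when \<open>k\<close> is 0.\<close>
    show "\<exists>D\<subseteq>?X. finite D \<and> card D \<le> Suc k \<and> x \<in> D \<and> (\<forall>h\<in>H. h ` D \<subseteq> D)"
    proof (cases "finite (C x) \<and> card (C x) \<le> k")
      case True
      have "h ` C x \<subseteq> C x" if "h \<in> H" for h
      proof (rule image_subsetI)
        fix y assume y: "y \<in> C x"
        then have "h y \<in> C y" using H_cls[OF that] cls_sub[OF x] by blast
        then show "h y \<in> C x" using cls_eq[OF x y] by simp
      qed
      then show ?thesis using True cls_sub[OF x] cls_refl[OF x] by (intro exI[of _ "C x"]) auto
    next
      case False
      have "h x = x" if h: "h \<in> H" for h
      proof -
        obtain T where T: "T \<in> \<T>" "h = closed_up ?X T (B T)" using h by (auto simp: H_def)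
        have "y \<notin> B T" if "y \<in> C x" for y using False cls_eq[OF x that] by (simp add: B)
        then have "C x \<inter> B T = {}" by blast
        then show ?thesis using partial_isomorphism.closed_up_id[OF pi[OF T(1)] x] T(2) by simp
      qed
      then show ?thesis using x by (intro exI[of _ "{x}"]) auto
    qed
  qed
  moreover have lists: "gs \<in> lists (mp_bij M)" if "gs \<in> lists H" for gs using that H_mp by auto
  have "word_map ?X ` lists H \<subseteq> mp_bij M" using word_map_mp_bij[OF lists] by blast
  moreover have "(\<lambda>x\<in>?X. x) \<in> word_map ?X ` lists H"
    by (rule image_eqI[of _ _ "[]"]) (simp_all add: word_map_simps)
  moreover have "compose ?X (word_map ?X gs) (word_map ?X hs) \<in> word_map ?X ` lists H"
    if "gs \<in> lists H" "hs \<in> lists H" for gs hs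
    using word_map_append[OF lists[OF that(1)] lists[OF that(2)]] that by (metis append_in_lists_conv imageI)
  moreover have "word_map ?X gs x \<in> C x" if gs: "gs \<in> lists H" and x: "x \<in> ?X" for gs x
    using gs
  proof (induction gs)
    case Nil
    then show ?case using x cls_refl by (simp add: word_map_simps)
  next
    case (Cons h gs)
    then have "word_map ?X gs x \<in> C x" by simp
    moreover from this have "h (word_map ?X gs x) \<in> C (word_map ?X gs x)"
      using H_cls[of h] Cons.hyps cls_sub[OF x] by blast
    ultimately show ?case using x cls_eq[OF x] by (simp add: word_map_simps compose_eq)
  qed
  moreover have "\<exists>T'\<in>word_map ?X ` lists H. \<forall>x\<in>B T. T' x = T x" if T: "T \<in> \<T>" for T
  proof
    let ?h = "closed_up ?X T (B T)"
    have h: "?h \<in> H" using T by (simp add: H_def)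
    have "word_map ?X [?h] \<in> word_map ?X ` lists H" using h by (intro imageI) simp
    moreover have "word_map ?X [?h] = ?h"
      unfolding word_map_simps using h H_mp mp_bij_ext[of ?h M] mp_bij_in_space[of ?h M]
      by (intro compose_Id) auto
    ultimately show "?h \<in> word_map ?X ` lists H" by simp
    show "\<forall>x\<in>B T. ?h x = T x" using partial_isomorphism.closed_up_in[OF pi[OF T]] by blast
  qed
  ultimately show ?thesis by (intro exI[of _ "word_map ?X ` lists H"]) blast
qed

section \<open>Measurability of conditions on orbits\<close>

context standard_prob
begin

lemma sets_mem_orbit:
  fixes I :: "nat set"
  assumes "\<And>i. i \<in> I \<Longrightarrow> a i \<in> mp_bij M" "\<And>x. x \<in> space M \<Longrightarrow> C x = (\<lambda>i. a i x) ` I"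
    and "T \<in> mp_bij M"
  shows "{x \<in> space M. T x \<in> C x} \<in> sets M"
proof -
  have "{x \<in> space M. T x \<in> C x} = (\<Union>i\<in>I. {x \<in> space M. T x = a i x})"
    using assms(2) by auto
  also have "\<dots> \<in> sets M"
    by (rule sets.countable_UN'') (use assms eq_measurable in auto)
  finally show ?thesis .
qed

text \<open>An orbit has at most \<open>k\<close> points iff some set of at most \<open>k\<close>
  indices already represents all its points. There are countably many such index sets, and each
  condition is built from countably many coincidence sets.\<close>

lemma sets_card_orbit_le:
  fixes I :: "nat set"
  assumes a: "\<And>i. i \<in> I \<Longrightarrow> a i \<in> mp_bij M" and C: "\<And>x. x \<in> space M \<Longrightarrow> C x = (\<lambda>i. a i x) ` I"
  shows "{x \<in> space M. finite (C x) \<and> card (C x) \<le> k} \<in> sets M"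
proof -
  define \<J> where "\<J> = {J. finite J \<and> J \<subseteq> I \<and> card J \<le> k}"
  have "countable \<J>"
    by (rule countable_subset[OF _ countable_Collect_finite]) (auto simp: \<J>_def)
  have iff: "finite (C x) \<and> card (C x) \<le> k \<longleftrightarrow> (\<exists>J\<in>\<J>. \<forall>i\<in>I. \<exists>j\<in>J. a i x = a j x)" if x: "x \<in> space M" for x
  proof
    assume fin: "finite (C x) \<and> card (C x) \<le> k"
    define r where "r y = (SOME i. i \<in> I \<and> a i x = y)" for y
    have r: "r y \<in> I \<and> a (r y) x = y" if "y \<in> C x" for y
      unfolding r_def by (rule someI_ex) (use that C[OF x] in auto)
    have "r ` C x \<in> \<J>" using fin r card_image_le[of "C x" r] by (auto simp: \<J>_def)
    moreover have "\<forall>i\<in>I. \<exists>j\<in>r ` C x. a i x = a j x" using r C[OF x] by auto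
    ultimately show "\<exists>J\<in>\<J>. \<forall>i\<in>I. \<exists>j\<in>J. a i x = a j x" by blast
  next
    assume "\<exists>J\<in>\<J>. \<forall>i\<in>I. \<exists>j\<in>J. a i x = a j x"
    then obtain J where J: "finite J" "J \<subseteq> I" "card J \<le> k" "\<forall>i\<in>I. \<exists>j\<in>J. a i x = a j x"
      by (auto simp: \<J>_def)
    have sub: "C x \<subseteq> (\<lambda>j. a j x) ` J" using J(4) C[OF x] by auto
    have "card (C x) \<le> card ((\<lambda>j. a j x) ` J)" by (rule card_mono) (use J(1) sub in auto)
    also have "\<dots> \<le> k" using card_image_le[OF J(1)] J(3) le_trans by blast
    finally show "finite (C x) \<and> card (C x) \<le> k" using finite_subset[OF sub] J(1) by auto
  qed
  have "{x \<in> space M. finite (C x) \<and> card (C x) \<le> k}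
      = (\<Union>J\<in>\<J>. {x \<in> space M. \<forall>i\<in>I. \<exists>j\<in>J. a i x = a j x})"
    using iff by auto
  also have "\<dots> \<in> sets M"
  proof (rule sets.countable_UN''[OF \<open>countable \<J>\<close>])
    fix J assume J: "J \<in> \<J>"
    have "{x \<in> space M. \<forall>i\<in>I. \<exists>j\<in>J. a i x = a j x}
        = space M - (\<Union>i\<in>I. space M - (\<Union>j\<in>J. {x \<in> space M. a i x = a j x}))" by auto
    also have "\<dots> \<in> sets M"
    proof (intro sets.Diff sets.top sets.countable_UN'')
      fix i j assume "i \<in> I" "j \<in> J"
      then show "{x \<in> space M. a i x = a j x} \<in> sets M"
        using J a by (intro eq_measurable) (auto simp: \<J>_def)
    qed auto
    finally show "{x \<in> space M. \<forall>i\<in>I. \<exists>j\<in>J. a i x = a j x} \<in> sets M" .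
  qed
  finally show ?thesis .
qed

end

text \<open>The assumptions \<open>C_refl\<close> and \<open>C_eq\<close> hold at every point,
  whereas \<open>fin\<close>, \<open>inc\<close> and \<open>union\<close> hold almost everywhere:
  this is what remains of hyperfiniteness once the finite relations are replaced by orbits.\<close>

locale hyperfinite_orbits = standard_prob +
  fixes R :: "('a \<times> 'a) set" and C :: "nat \<Rightarrow> 'a \<Rightarrow> 'a set"
    and I :: "nat \<Rightarrow> nat set" and a :: "nat \<Rightarrow> nat \<Rightarrow> 'a \<Rightarrow> 'a"
  assumes R: "equiv (space M) R"
    and a: "\<And>n i. i \<in> I n \<Longrightarrow> a n i \<in> mp_bij M"
    and C: "\<And>n x. x \<in> space M \<Longrightarrow> C n x = (\<lambda>i. a n i x) ` I n"
    and C_refl: "\<And>n x. x \<in> space M \<Longrightarrow> x \<in> C n x"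
    and C_eq: "\<And>n x y. x \<in> space M \<Longrightarrow> y \<in> C n x \<Longrightarrow> C n y = C n x"
    and fin: "AE x in M. \<forall>n. finite (C n x)"
    and inc: "AE x in M. \<forall>n. C n x \<subseteq> C (Suc n) x"
    and union: "AE x in M. R `` {x} = (\<Union>n. C n x)"
begin

lemma C_sub: "x \<in> space M \<Longrightarrow> C n x \<subseteq> space M"
  using C mp_bij_in_space[OF a] by auto

definition "good n k T = {x \<in> space M. T x \<in> C n x \<and> finite (C n x) \<and> card (C n x) \<le> k}"

lemma good_sets:
  assumes "T \<in> mp_bij M"
  shows "good n k T \<in> sets M"
proof -
  have "good n k T = {x \<in> space M. T x \<in> C n x} \<inter> {x \<in> space M. finite (C n x) \<and> card (C n x) \<le> k}"
    by (auto simp: good_def)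
  also have "\<dots> \<in> sets M"
    by (intro sets.Int sets_mem_orbit[OF a C assms] sets_card_orbit_le[OF a C])
  finally show ?thesis .
qed

text \<open>Exhaustion gives one \<open>n\<close> for which every \<open>T\<close> of the finite set
  leaves its class only on a set of measure below \<open>\<eta> / 2\<close>. Then, for this
  \<open>n\<close>, almost all classes are finite, so some \<open>k\<close> bounds their size up to
  another \<open>\<eta> / 2\<close>.\<close>

lemma good_approximation:
  assumes \<T>: "finite \<T>" "\<T> \<subseteq> mp_bij M" "\<And>T. T \<in> \<T> \<Longrightarrow> AE x in M. (T x, x) \<in> R" and "0 < \<eta>"
  shows "\<exists>n k. \<forall>T\<in>\<T>. prob (space M - good n k T) < \<eta>"
proof -
  define D where "D T n = space M - {x \<in> space M. T x \<in> C n x}" for T n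
  define E where "E n k = space M - {x \<in> space M. finite (C n x) \<and> card (C n x) \<le> k}" for n k
  have D_sets: "D T n \<in> sets M" if "T \<in> \<T>" for T n
    unfolding D_def using sets_mem_orbit[where I = "I n" and a = "a n" and C = "C n" and T = T, OF a C] that \<T>(2) by auto
  have E_sets: "E n k \<in> sets M" for n k
    unfolding E_def using sets_card_orbit_le[where I = "I n" and a = "a n" and C = "C n", OF a C] by auto
  have "\<forall>T\<in>\<T>. eventually (\<lambda>n. prob (D T n) < \<eta> / 2) sequentially"
  proof
    fix T assume T: "T \<in> \<T>"
    have "AE x in M. eventually (\<lambda>n. x \<notin> D T n) sequentially"
      using \<T>(3)[OF T] inc union AE_space
    proof eventually_elim
      case (elim x)
      have "(x, T x) \<in> R" using R elim(1) by (auto simp: equiv_def sym_def)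
      then obtain m where m: "T x \<in> C m x" using elim(3) by auto
      have "C m x \<subseteq> C n x" if "m \<le> n" for n
        using lift_Suc_mono_le[of "\<lambda>n. C n x"] elim(2) that by blast
      with m show ?case by (auto simp: D_def eventually_sequentially)
    qed
    then have "(\<lambda>n. prob (D T n)) \<longlonglongrightarrow> 0" using prob_tendsto_0[of "D T"] D_sets[OF T] by blast
    then show "eventually (\<lambda>n. prob (D T n) < \<eta> / 2) sequentially"
      using order_tendstoD(2) \<open>0 < \<eta>\<close> half_gt_zero by blast
  qed
  then have "eventually (\<lambda>n. \<forall>T\<in>\<T>. prob (D T n) < \<eta> / 2) sequentially"
    by (rule eventually_ball_finite[OF \<T>(1)])
  then obtain n where n: "\<And>T. T \<in> \<T> \<Longrightarrow> prob (D T n) < \<eta> / 2"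
    unfolding eventually_sequentially by blast
  have "AE x in M. eventually (\<lambda>k. x \<notin> E n k) sequentially"
    using fin by eventually_elim (auto simp: E_def eventually_sequentially)
  then have "(\<lambda>k. prob (E n k)) \<longlonglongrightarrow> 0" using prob_tendsto_0[of "E n"] E_sets by blast
  then have "eventually (\<lambda>k. prob (E n k) < \<eta> / 2) sequentially"
    using order_tendstoD(2) \<open>0 < \<eta>\<close> half_gt_zero by blast
  then obtain k where k: "prob (E n k) < \<eta> / 2" unfolding eventually_sequentially by blast
  have "prob (space M - good n k T) < \<eta>" if T: "T \<in> \<T>" for T
  proof -
    have "space M - good n k T = D T n \<union> E n k" by (auto simp: good_def D_def E_def)
    then have "prob (space M - good n k T) \<le> prob (D T n) + prob (E n k)"
      using measure_Un_le[OF D_sets[OF T] E_sets] by simp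
    with n[OF T] k show ?thesis by linarith
  qed
  then show ?thesis by blast
qed

lemma full_groupI:
  assumes "T \<in> mp_bij M" "\<And>x. x \<in> space M \<Longrightarrow> T x \<in> C n x"
  shows "coset M T \<in> carrier (full_group M R)"
proof -
  have "AE x in M. (T x, x) \<in> R"
    using union AE_space
  proof eventually_elim
    case (elim x)
    then have "(x, T x) \<in> R" using assms(2)[of x] by auto
    then show ?case using R by (auto simp: equiv_def sym_def)
  qed
  then show ?thesis unfolding carrier_full_group using assms(1) by blast
qed

text \<open>For \<open>g\<close> represented by \<open>T\<close>, the approximating
  \<open>g'\<close> is the class of the element \<open>T'\<close> of \<open>S\<close> that agrees
  with \<open>T\<close> on \<open>good m k T\<close>, and \<open>\<gamma>\<close> is left
  translation by \<open>T'\<close>.\<close>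

lemma levy:
  assumes "atomless M" and F: "finite F" "F \<subseteq> carrier (full_group M R)" and "0 < \<eta>" "0 < \<delta>"
  shows "\<exists>(S::('a \<Rightarrow> 'a) set) n \<Phi> w.
    levy_approximation (full_group M R) (uniform_dist M) F \<eta> S n \<Phi> w \<and> (\<Sum>i<n. (w i)\<^sup>2) < \<delta>"
proof -
  let ?X = "space M"
  obtain \<T> where \<T>: "finite \<T>" "\<T> \<subseteq> {T \<in> mp_bij M. AE x in M. (T x, x) \<in> R}" "F = coset M ` \<T>"
    using finite_subset_image[OF F[unfolded carrier_full_group]] by blast
  then have \<T>_mp: "\<T> \<subseteq> mp_bij M" by blast
  have \<T>_R: "AE x in M. (T x, x) \<in> R" if "T \<in> \<T>" for T using that \<T>(2) by blast
  obtain m k where close: "\<And>T. T \<in> \<T> \<Longrightarrow> prob (space M - good m k T) < \<eta>"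
    using good_approximation[OF \<T>(1) \<T>_mp \<T>_R \<open>0 < \<eta>\<close>] by metis
  have good: "good m k T \<in> sets M" if "T \<in> \<T>" for T using that \<T>_mp by (intro good_sets) blast
  have "\<exists>S. finite S \<and> S \<subseteq> mp_bij M \<and> (\<lambda>x\<in>?X. x) \<in> S \<and>
     (\<forall>s\<in>S. \<forall>t\<in>S. compose ?X s t \<in> S) \<and> (\<forall>s\<in>S. \<forall>x\<in>?X. s x \<in> C m x) \<and>
     (\<forall>T\<in>\<T>. \<exists>T'\<in>S. \<forall>x\<in>good m k T. T' x = T x)"
    by (rule finite_group_approximation[where C = "C m" and B = "good m k"])
      (fact \<T>(1) \<T>_mp C_sub C_refl C_eq good_def good)+
  then obtain S where S: "finite S" "S \<subseteq> mp_bij M" "(\<lambda>x\<in>?X. x) \<in> S"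
    and S_all: "\<forall>s\<in>S. \<forall>t\<in>S. compose ?X s t \<in> S" "\<forall>s\<in>S. \<forall>x\<in>?X. s x \<in> C m x"
      "\<forall>T\<in>\<T>. \<exists>T'\<in>S. \<forall>x\<in>good m k T. T' x = T x"
    by (elim exE conjE) (rule that)
  have closed: "compose ?X s t \<in> S" if "s \<in> S" "t \<in> S" for s t using S_all(1) that by blast
  have S_C: "s x \<in> C m x" if "s \<in> S" "x \<in> ?X" for s x using S_all(2) that by blast
  \<comment> \<open>The blocks give only a weak inequality; halving makes the final bound
    strict.\<close>
  have "0 < \<delta> / 2" using \<open>0 < \<delta>\<close> by simp
  from invariant_blocks[OF \<open>atomless M\<close> this S closed] obtain n idx where
    idx: "idx \<in> M \<rightarrow>\<^sub>M count_space UNIV" "\<And>x. x \<in> ?X \<Longrightarrow> idx x < (n::nat)"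
    and idx_inv: "\<And>s x. s \<in> S \<Longrightarrow> x \<in> ?X \<Longrightarrow> idx (s x) = idx x"
    and small: "\<And>i. prob {x \<in> ?X. idx x = i} \<le> \<delta> / 2"
    by blast
  define w where "w i = prob {x \<in> ?X. idx x = i}" for i
  define \<Psi> where "\<Psi> = block_map ?X idx"
  have \<Psi>: "\<Psi> xs \<in> mp_bij M" if "length xs = n" "set xs \<subseteq> S" for xs
    unfolding \<Psi>_def
  proof (rule block_map_mp_bij[OF idx(1)])
    show "idx x < length xs" if "x \<in> ?X" for x using idx(2)[OF that] \<open>length xs = n\<close> by simp
  qed (fact S(2) that(2) idx_inv)+
  have \<Psi>_C: "\<Psi> xs x \<in> C m x" if xs: "length xs = n" "set xs \<subseteq> S" and x: "x \<in> ?X" for xs x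
  proof -
    have "xs ! idx x \<in> S" using idx(2)[OF x] xs nth_mem by blast
    then show ?thesis using S_C x by (simp add: \<Psi>_def block_map_def)
  qed
  have "levy_approximation (full_group M R) (uniform_dist M) F \<eta> S n (\<lambda>xs. coset M (\<Psi> xs)) w"
    unfolding levy_approximation_def
  proof (intro conjI allI impI ballI)
    show "finite S" "S \<noteq> {}" using S by auto
    show "0 \<le> w i" for i by (simp add: w_def)
    show "coset M (\<Psi> xs) \<in> carrier (full_group M R)" if "length xs = n \<and> set xs \<subseteq> S" for xs
      using that by (intro full_groupI[of _ m] \<Psi> \<Psi>_C) auto
    show "uniform_dist M (coset M (\<Psi> xs)) (coset M (\<Psi> ys)) \<le> hamming w xs ys"
      if "length xs = n \<and> set xs \<subseteq> S \<and> length ys = n \<and> set ys \<subseteq> S" for xs ys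
      unfolding \<Psi>_def w_def
      by (rule uniform_dist_block_map[OF idx]) (use that \<Psi>[unfolded \<Psi>_def] in auto)
    fix g assume "g \<in> F"
    then obtain T where T: "T \<in> \<T>" "g = coset M T" using \<T>(3) by blast
    then obtain T' where T': "T' \<in> S" "\<And>x. x \<in> good m k T \<Longrightarrow> T' x = T x" using S_all(3) by blast
    have mp: "T \<in> mp_bij M" "T' \<in> mp_bij M" using T(1) \<T>_mp T'(1) S(2) by auto
    have "prob {x \<in> ?X. T x \<noteq> T' x} \<le> prob (?X - good m k T)"
      by (rule finite_measure_mono) (use T'(2) good_sets[OF mp(1)] in auto)
    then have dist: "uniform_dist M g (coset M T') < \<eta>"
      using close[OF T(1)] by (simp add: T(2) uniform_dist_coset[OF mp])
    have map: "coset M (\<Psi> (map (compose ?X T') xs)) = coset M T' \<otimes>\<^bsub>full_group M R\<^esub> coset M (\<Psi> xs)"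
      if "length xs = n \<and> set xs \<subseteq> S" for xs
    proof -
      have "\<Psi> (map (compose ?X T') xs) = compose ?X T' (\<Psi> xs)"
        unfolding \<Psi>_def by (rule block_map_map) (use idx(2) that in auto)
      then show ?thesis using Aut_mult[OF mp(2) \<Psi>] that by simp
    qed
    show "\<exists>g'\<in>carrier (full_group M R). \<exists>\<gamma>. bij_betw \<gamma> S S \<and> uniform_dist M g g' < \<eta> \<and>
        (\<forall>xs. length xs = n \<and> set xs \<subseteq> S \<longrightarrow>
          coset M (\<Psi> (map \<gamma> xs)) = g' \<otimes>\<^bsub>full_group M R\<^esub> coset M (\<Psi> xs))"
    proof (intro bexI exI conjI allI impI)
      show "coset M T' \<in> carrier (full_group M R)" by (rule full_groupI[OF mp(2) S_C[OF T'(1)]])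
      show "bij_betw (compose ?X T') S S" by (rule bij_betw_compose_left[OF S(1,2) T'(1) closed[OF T'(1)]])
    qed (fact dist map)+
  qed
  moreover have "(\<Sum>i<n. (w i)\<^sup>2) < \<delta>"
    using sum_square_prob_le[OF idx(1) small, of n] \<open>0 < \<delta>\<close> unfolding w_def by linarith
  ultimately show ?thesis by blast
qed

lemma extremely_amenable_full_group:
  assumes "atomless M"
  shows "extremely_amenable TYPE('k) (full_group M R) (full_group_topology M R)"
  unfolding extremely_amenable_def
proof (intro conjI allI impI)
  show "topological_group (full_group M R) (full_group_topology M R)"
    by (rule topological_group_full_group[OF R])
  fix K :: "'k topology" and \<phi>
  assume K: "compact_space K \<and> Hausdorff_space K \<and> topspace K \<noteq> {} \<and>
    continuous_action (full_group M R) (full_group_topology M R) K \<phi>"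
  show "\<exists>x\<in>topspace K. \<forall>g\<in>carrier (full_group M R). \<phi> g x = x"
    by (rule fixed_point_criterion[OF Metric_space_full_group group_full_group[OF R]
          full_group_dist_right levy[OF assms]])
      (use K in \<open>auto simp: full_group_topology_def\<close>)
qed

end

theorem proposition8p1:
  fixes M :: "'a measure" and R :: "('a \<times> 'a) set"
  assumes "standard_probability_space M"
    and "pmp_equiv_rel M R"
    and "hyperfinite M R"
  shows "extremely_amenable TYPE('k) (full_group M R) (full_group_topology M R)"
proof -
  obtain F :: "nat \<Rightarrow> ('a \<times> 'a) set" where
    F: "\<And>n. pmp_equiv_rel M (F n)" "\<And>n. finite_rel M (F n)"
      "\<And>n. AE x in M. F n `` {x} \<subseteq> F (Suc n) `` {x}" "AE x in M. R `` {x} = (\<Union>n. F n `` {x})"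
    using assms(3) unfolding hyperfinite_def by blast
  have "\<forall>n. \<exists>\<Gamma> \<alpha>. group_action (\<Gamma> :: nat monoid) (space M) \<alpha> \<and> (\<forall>g\<in>carrier \<Gamma>. \<alpha> g \<in> mp_bij M) \<and>
      (AE x in M. F n `` {x} = orbit \<Gamma> \<alpha> x)"
    using F(1) unfolding pmp_equiv_rel_def by blast
  then obtain \<Gamma> \<alpha> where act: "\<And>n. group_action (\<Gamma> n :: nat monoid) (space M) (\<alpha> n)"
    and mp: "\<And>n g. g \<in> carrier (\<Gamma> n) \<Longrightarrow> \<alpha> n g \<in> mp_bij M"
    and orb: "\<And>n. AE x in M. F n `` {x} = orbit (\<Gamma> n) (\<alpha> n) x"
    by metis
  \<comment> \<open>A single null set for all \<open>n\<close>, obtained by countability; outside it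
    the relations and the orbits can be exchanged freely.\<close>
  have orb': "AE x in M. \<forall>n. F n `` {x} = orbit (\<Gamma> n) (\<alpha> n) x"
    using orb by (simp add: AE_all_countable)
  have "prob_space M" "standard_borel M" "atomless M"
    using assms(1) by (auto simp: standard_probability_space_def)
  \<comment> \<open>The orbits, rather than the classes of \<open>F n\<close>, serve as
    \<open>C\<close>: they form an exact partition, and their points are indexed by a set of
    naturals.\<close>
  interpret hyperfinite_orbits M R "\<lambda>n x. orbit (\<Gamma> n) (\<alpha> n) x" "\<lambda>n. carrier (\<Gamma> n)" \<alpha>
  proof (intro hyperfinite_orbits.intro standard_prob.intro standard_prob_axioms.intro
      hyperfinite_orbits_axioms.intro)
    show "equiv (space M) R" using assms(2) by (simp add: pmp_equiv_rel_def)
    show "orbit (\<Gamma> n) (\<alpha> n) x = (\<lambda>i. \<alpha> n i x) ` carrier (\<Gamma> n)" for n x by (auto simp: orbit_def)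
    show "x \<in> orbit (\<Gamma> n) (\<alpha> n) x" if "x \<in> space M" for n x
      by (rule group_action.orbit_refl[OF act that])
    show "orbit (\<Gamma> n) (\<alpha> n) y = orbit (\<Gamma> n) (\<alpha> n) x"
      if x: "x \<in> space M" and y: "y \<in> orbit (\<Gamma> n) (\<alpha> n) x" for n x y
    proof -
      have y_in: "y \<in> space M" using y mp_bij_in_space[OF mp x] by (auto simp: orbit_def)
      have sub: "orbit (\<Gamma> n) (\<alpha> n) z \<subseteq> space M" if "z \<in> space M" for z
        using mp_bij_in_space[OF mp that] by (auto simp: orbit_def)
      have "x \<in> orbit (\<Gamma> n) (\<alpha> n) y" by (rule group_action.orbit_sym[OF act x y_in y])
      then show ?thesis
        using group_action.orbit_trans[OF act] x y y_in sub by blast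
    qed
    show "AE x in M. \<forall>n. finite (orbit (\<Gamma> n) (\<alpha> n) x)"
    proof -
      have "AE x in M. \<forall>n. finite (F n `` {x})"
        using F(2) by (simp add: finite_rel_def AE_all_countable)
      with orb' show ?thesis by eventually_elim simp
    qed
    show "AE x in M. \<forall>n. orbit (\<Gamma> n) (\<alpha> n) x \<subseteq> orbit (\<Gamma> (Suc n)) (\<alpha> (Suc n)) x"
    proof -
      have "AE x in M. \<forall>n. F n `` {x} \<subseteq> F (Suc n) `` {x}"
        using F(3) by (simp add: AE_all_countable)
      with orb' show ?thesis by eventually_elim simp
    qed
    show "AE x in M. R `` {x} = (\<Union>n. orbit (\<Gamma> n) (\<alpha> n) x)"
      using F(4) orb' by eventually_elim simp
  qed (use mp \<open>prob_space M\<close> \<open>standard_borel M\<close> in auto)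
  show ?thesis by (rule extremely_amenable_full_group) fact
qed

end
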